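(* Let $\Bbbk$ be a field and $G$ a graph that is prime over $\Bbbk$ with minimum degree $\delta(G)\ge 2$. Let $x\in V(G)$ and $N_G(x)=Y\cup Z$ be a partition with $Y\neq\emptyset$ and $Z\neq\emptyset$. Then $\mathcal{L}_x(G;Y,Z)$ is prime over $\Bbbk$.
   Context: $\operatorname{reg}_{\Bbbk}(G)=\max\{j\ge0:\widetilde H_{j-1}(\operatorname{Ind}(G[S]);\Bbbk)\neq0\text{ for some }S\subseteq V(G)\}$, $\operatorname{Ind}$ the independence complex. A connected graph $H$ is prime over $\Bbbk$ if $\operatorname{reg}_{\Bbbk}(H-v)<\operatorname{reg}_{\Bbbk}(H)$ for every vertex $v$. The Lozin transform $\mathcal{L}_x(G;Y,Z)$: delete $x$, add four new vertices $y,a,b,z$ with edges $ya,ab,bz$, and join $y$ to every vertex of $Y$ and $z$ to every vertex of $Z$. *)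

theory Defs
  imports Main
begin

definition simple_graph :: "'a set \<Rightarrow> 'a set set \<Rightarrow> bool" where
  "simple_graph V E \<longleftrightarrow> finite V \<and>
     (\<forall>e\<in>E. \<exists>u v. u \<noteq> v \<and> e = {u, v} \<and> u \<in> V \<and> v \<in> V)"

definition neighbors :: "'a set \<Rightarrow> 'a set set \<Rightarrow> 'a \<Rightarrow> 'a set" where
  "neighbors V E x = {u \<in> V. {x, u} \<in> E}"

definition connected_graph :: "'a set \<Rightarrow> 'a set set \<Rightarrow> bool" where
  "connected_graph V E \<longleftrightarrow> V \<noteq> {} \<and>
     (\<forall>u\<in>V. \<forall>w\<in>V. (\<lambda>p q. {p, q} \<in> E)\<^sup>*\<^sup>* u w)"

definition induced_edges :: "'a set set \<Rightarrow> 'a set \<Rightarrow> 'a set set" where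
  "induced_edges E S = {e \<in> E. e \<subseteq> S}"

definition ind_complex :: "'a set \<Rightarrow> 'a set set \<Rightarrow> 'a set set" where
  "ind_complex V E = {\<sigma>. \<sigma> \<subseteq> V \<and> (\<forall>e\<in>E. \<not> e \<subseteq> \<sigma>)}"

text \<open>Simplicial chains over a field: coefficient functions supported on faces of cardinality n
  (i.e. of dimension n-1); the empty face gives the augmentation (reduced homology).\<close>
definition chains :: "'a set set \<Rightarrow> nat \<Rightarrow> ('a set \<Rightarrow> 'k::field) set" where
  "chains K n = {c. \<forall>\<sigma>. c \<sigma> \<noteq> 0 \<longrightarrow> \<sigma> \<in> K \<and> card \<sigma> = n}"

text \<open>Simplicial boundary, orientation induced by the linear order of the vertices:
  the coefficient of sigma in the boundary of sigma + v is (-1)^(number of vertices of sigma below v).\<close>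
definition bd :: "'a::linorder set \<Rightarrow> 'a set set \<Rightarrow> ('a set \<Rightarrow> 'k::field) \<Rightarrow> ('a set \<Rightarrow> 'k)" where
  "bd V K c = (\<lambda>\<sigma>. \<Sum>v\<in>V - \<sigma>.
      if insert v \<sigma> \<in> K then (-1) ^ card {u \<in> \<sigma>. u < v} * c (insert v \<sigma>) else 0)"

text \<open>homology_nonzero TYPE('k) V K j  means  reduced H_{j-1}(K; k) is nonzero:
  some (j-1)-cycle is not a boundary.\<close>
definition homology_nonzero :: "'k::field itself \<Rightarrow> 'a::linorder set \<Rightarrow> 'a set set \<Rightarrow> nat \<Rightarrow> bool" where
  "homology_nonzero _ V K j \<longleftrightarrow>
     (\<exists>z::'a set \<Rightarrow> 'k. z \<in> chains K j \<and>
        (\<forall>\<sigma>\<in>K. card \<sigma> + 1 = j \<longrightarrow> bd V K z \<sigma> = 0) \<and>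
        \<not> (\<exists>w::'a set \<Rightarrow> 'k. w \<in> chains K (j + 1) \<and>
              (\<forall>\<sigma>\<in>K. card \<sigma> = j \<longrightarrow> bd V K w \<sigma> = z \<sigma>)))"

definition reg :: "'k::field itself \<Rightarrow> 'a::linorder set \<Rightarrow> 'a set set \<Rightarrow> nat" where
  "reg k V E = Max {j. \<exists>S\<subseteq>V.
      homology_nonzero k S (ind_complex S (induced_edges E S)) j}"

definition delete_vertex_edges :: "'a set set \<Rightarrow> 'a \<Rightarrow> 'a set set" where
  "delete_vertex_edges E v = {e \<in> E. v \<notin> e}"

definition prime_graph :: "'k::field itself \<Rightarrow> 'a::linorder set \<Rightarrow> 'a set set \<Rightarrow> bool" where
  "prime_graph k V E \<longleftrightarrow> connected_graph V E \<and>
     (\<forall>v\<in>V. reg k (V - {v}) (delete_vertex_edges E v) < reg k V E)"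

definition lozin_vertices :: "'a set \<Rightarrow> 'a \<Rightarrow> 'a \<Rightarrow> 'a \<Rightarrow> 'a \<Rightarrow> 'a \<Rightarrow> 'a set" where
  "lozin_vertices V x y a b z = (V - {x}) \<union> {y, a, b, z}"

definition lozin_edges :: "'a set set \<Rightarrow> 'a \<Rightarrow> 'a set \<Rightarrow> 'a set \<Rightarrow> 'a \<Rightarrow> 'a \<Rightarrow> 'a \<Rightarrow> 'a \<Rightarrow> 'a set set" where
  "lozin_edges E x Y Z y a b z =
     delete_vertex_edges E x \<union> {{y, a}, {a, b}, {b, z}}
     \<union> {{y, u} | u. u \<in> Y} \<union> {{z, u} | u. u \<in> Z}"

end

theory Submission
  imports Defs "HOL-Library.Function_Algebras"
begin

text \<open>The Lozin transform L suspends: H_{i+1}(Ind L) is isomorphic to H_i(Ind G), and the same holds for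
  every induced subgraph of L that contains all of y, a, b, z. For a prime graph of regularity r this
  gives nonzero homology on all of L one degree higher than on G, and bounds the degree on the proper
  induced subgraphs containing y, a, b, z. If one of y, a, b, z is missing, the vertices among them
  that remain can be removed one at a time with the exact sequence of deletion and link; this ends at
  proper induced subgraphs of G because Y and Z are nonempty.\<close>

section \<open>Chains and the cone operator\<close>

text \<open>Adding a vertex v to a graph glues a cone over the independence complex of its
  non-neighbours. Every chain then splits uniquely as p + v q, and the Leibniz rule d(v f) = f - v
  df turns arguments with exact sequences into calculations with the pair (p, q). The bound for
  subgraphs missing one of y, a, b, z leaves little room: each passage to a link costs one degree,
  and G to L may cost only one in total. The critical case has a missing and y, z present. After
  passing to the link of z, peeling off y as well could cost a second degree. Instead, y is kept: in
  that link no vertex of Z is left, so y has exactly the neighbours that x has there, and it can be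
  renamed to x. The result is an induced subgraph of G, proper because it misses the nonempty set
  Z.\<close>

definition sgn_at :: "'a::linorder \<Rightarrow> 'a set \<Rightarrow> 'k::field" where
  "sgn_at v \<sigma> = (-1) ^ card {u \<in> \<sigma>. u < v}"

text \<open>The index is the cardinality of the faces. It is an integer so that n - 1 and n - 2 keep
  their meaning below zero, where the space is 0.\<close>

definition chain_space :: "'a set set \<Rightarrow> int \<Rightarrow> ('a set \<Rightarrow> 'k::field) set" where
  "chain_space K n = {f. \<forall>\<sigma>. f \<sigma> \<noteq> 0 \<longrightarrow> \<sigma> \<in> K \<and> int (card \<sigma>) = n}"

text \<open>The exterior product of v with f: the sign moves v from the front to its place in the
  vertex order, and the part of f on faces containing v is lost.\<close>

definition cone_op :: "'a::linorder \<Rightarrow> ('a set \<Rightarrow> 'k::field) \<Rightarrow> 'a set \<Rightarrow> 'k" where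
  "cone_op v f = (\<lambda>\<sigma>. if v \<in> \<sigma> then sgn_at v (\<sigma> - {v}) * f (\<sigma> - {v}) else 0)"

definition avoids :: "'a \<Rightarrow> ('a set \<Rightarrow> 'k::field) \<Rightarrow> bool" where
  "avoids v f \<longleftrightarrow> (\<forall>\<sigma>. v \<in> \<sigma> \<longrightarrow> f \<sigma> = 0)"

text \<open>Coefficient functions live on all sets, but \<open>card\<close> is 0 on infinite ones,
  so the sign rules can fail there.\<close>

definition finitary :: "('a set \<Rightarrow> 'k::field) \<Rightarrow> bool" where
  "finitary f \<longleftrightarrow> (\<forall>\<sigma>. infinite \<sigma> \<longrightarrow> f \<sigma> = 0)"

text \<open>Not the simplicial join: for L inside K this is K with a cone of apex v glued along L,
  so K is the deletion of v and L its link.\<close>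

definition join :: "'a \<Rightarrow> 'a set set \<Rightarrow> 'a set set \<Rightarrow> 'a set set" where
  "join v K L = K \<union> insert v ` L"

lemma sgn_at_square: "sgn_at v \<sigma> * (sgn_at v \<sigma> * c) = (c::'k::field)"
proof -
  have "sgn_at v \<sigma> * sgn_at v \<sigma> = (1::'k)"
    unfolding sgn_at_def by (simp flip: power_add)
  then show ?thesis by (simp flip: mult.assoc)
qed

lemma sgn_at_insert:
  assumes "finite \<tau>" "u \<notin> \<tau>"
  shows "sgn_at v (insert u \<tau>) = (if u < v then - sgn_at v \<tau> else sgn_at v \<tau> :: 'k::field)"
proof -
  have "{w \<in> insert u \<tau>. w < v} = (if u < v then insert u {w \<in> \<tau>. w < v} else {w \<in> \<tau>. w < v})"
    by auto
  then show ?thesis using assms by (auto simp: sgn_at_def)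
qed

text \<open>Anticommutativity of the exterior product: of two distinct vertices exactly one lies
  below the other, so exactly one sign changes.\<close>

lemma sgn_at_swap:
  assumes "finite \<tau>" "u \<notin> \<tau>" "v \<notin> \<tau>" "u \<noteq> v"
  shows "sgn_at u (insert v \<tau>) * sgn_at v (insert u \<tau>) = - (sgn_at v \<tau> * sgn_at u \<tau> :: 'k::field)"
  using assms by (cases u v rule: linorder_cases) (auto simp: sgn_at_insert)

lemma cone_op_add [simp]: "cone_op v (f + g) = cone_op v f + cone_op v g"
  by (auto simp: cone_op_def fun_eq_iff algebra_simps)

lemma cone_op_minus [simp]: "cone_op v (- f) = - cone_op v f"
  by (auto simp: cone_op_def fun_eq_iff)

lemma cone_op_diff [simp]: "cone_op v (f - g) = cone_op v f - cone_op v g"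
  by (auto simp: cone_op_def fun_eq_iff algebra_simps)

lemma cone_op_zero [simp]: "cone_op v 0 = 0"
  by (auto simp: cone_op_def fun_eq_iff)

lemma avoids_arith [simp]:
  "avoids v f \<Longrightarrow> avoids v g \<Longrightarrow> avoids v (f + g)"
  "avoids v f \<Longrightarrow> avoids v g \<Longrightarrow> avoids v (f - g)"
  "avoids v f \<Longrightarrow> avoids v (- f)"
  "avoids v 0"
  by (auto simp: avoids_def)

lemma avoids_cone_op [simp]: "avoids v f \<Longrightarrow> v \<noteq> u \<Longrightarrow> avoids v (cone_op u f)"
  by (auto simp: avoids_def cone_op_def)

lemma finitary_arith [simp]:
  "finitary f \<Longrightarrow> finitary g \<Longrightarrow> finitary (f + g)"
  "finitary f \<Longrightarrow> finitary g \<Longrightarrow> finitary (f - g)"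
  "finitary f \<Longrightarrow> finitary (- f)"
  "finitary 0"
  by (auto simp: finitary_def)

lemma finitary_cone_op [simp]: "finitary f \<Longrightarrow> finitary (cone_op v f)"
  by (auto simp: finitary_def cone_op_def)

text \<open>Faces without v see only p; a face with v sees only q, up to a sign.\<close>

lemma split_unique:
  assumes "p + cone_op v q = 0" "avoids v p" "avoids v q"
  shows "p = 0 \<and> q = 0"
proof -
  have e: "p \<sigma> + cone_op v q \<sigma> = 0" for \<sigma>
    using assms(1) by (metis plus_fun_apply zero_fun_apply)
  have "p \<sigma> = 0" for \<sigma>
    using e[of \<sigma>] assms(2) by (cases "v \<in> \<sigma>") (auto simp: avoids_def cone_op_def)
  moreover have "q \<sigma> = 0" for \<sigma>
  proof (cases "v \<in> \<sigma>")
    case True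
    then show ?thesis using assms(3) by (auto simp: avoids_def)
  next
    case False
    then have "sgn_at v \<sigma> * q \<sigma> = 0"
      using e[of "insert v \<sigma>"] assms(2) by (auto simp: avoids_def cone_op_def)
    then show ?thesis by (simp add: sgn_at_def)
  qed
  ultimately show ?thesis by (auto simp: fun_eq_iff)
qed

lemma split_unique':
  assumes "p + cone_op v q = p' + cone_op v q'" "avoids v p" "avoids v q" "avoids v p'" "avoids v q'"
  shows "p = p' \<and> q = q'"
  using split_unique[of "p - p'" v "q - q'"] assms by (simp add: algebra_simps)

lemma chain_space_arith [simp]:
  "f \<in> chain_space K n \<Longrightarrow> g \<in> chain_space K n \<Longrightarrow> f + g \<in> chain_space K n"
  "f \<in> chain_space K n \<Longrightarrow> g \<in> chain_space K n \<Longrightarrow> f - g \<in> chain_space K n"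
  "f \<in> chain_space K n \<Longrightarrow> - f \<in> chain_space K n"
  "0 \<in> chain_space K n"
  by (force simp: chain_space_def)+

lemma chain_space_mono: "f \<in> chain_space K n \<Longrightarrow> K \<subseteq> L \<Longrightarrow> f \<in> chain_space L n"
  by (auto simp: chain_space_def)

lemma avoids_chain: "f \<in> chain_space K n \<Longrightarrow> K \<subseteq> Pow W \<Longrightarrow> v \<notin> W \<Longrightarrow> avoids v f"
  by (force simp: chain_space_def avoids_def)

lemma finitary_chain: "f \<in> chain_space K n \<Longrightarrow> K \<subseteq> Pow W \<Longrightarrow> finite W \<Longrightarrow> finitary f"
  by (force simp: chain_space_def finitary_def dest: finite_subset)

text \<open>Sorting the faces by whether they contain v. This direct sum decomposition is what all
  later homology arguments calculate with.\<close>

lemma chain_space_join: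
  assumes K: "K \<subseteq> Pow W" and L: "L \<subseteq> Pow W" and v: "v \<notin> W" and W: "finite W"
  shows "f \<in> chain_space (join v K L) n \<longleftrightarrow>
    (\<exists>p\<in>chain_space K n. \<exists>q\<in>chain_space L (n - 1). f = p + cone_op v q)" (is "?l \<longleftrightarrow> ?r")
proof
  assume f: ?l
  define p where "p = (\<lambda>\<sigma>. if v \<in> \<sigma> then 0 else f \<sigma>)"
  define q where "q = (\<lambda>\<sigma>. if v \<in> \<sigma> then 0 else sgn_at v \<sigma> * f (insert v \<sigma>))"
  have "f = p + cone_op v q"
    by (auto simp: fun_eq_iff p_def q_def cone_op_def insert_absorb sgn_at_square)
  moreover have "p \<in> chain_space K n"
    using f by (auto simp: chain_space_def p_def join_def)
  moreover have "q \<in> chain_space L (n - 1)"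
  proof -
    have "\<sigma> \<in> L \<and> int (card \<sigma>) = n - 1" if "v \<notin> \<sigma>" "f (insert v \<sigma>) \<noteq> 0" for \<sigma>
    proof -
      have i: "insert v \<sigma> \<in> join v K L" "int (card (insert v \<sigma>)) = n"
        using f that by (auto simp: chain_space_def)
      then obtain \<tau> where "\<tau> \<in> L" "insert v \<sigma> = insert v \<tau>"
        using K v by (auto simp: join_def)
      moreover have "v \<notin> \<tau>" using \<open>\<tau> \<in> L\<close> L v by auto
      ultimately have "\<sigma> \<in> L" using that(1) by (metis insert_ident)
      moreover have "finite \<sigma>" using \<open>\<sigma> \<in> L\<close> L W by (auto dest: finite_subset)
      ultimately show ?thesis using i that by auto
    qed
    then show ?thesis by (auto simp: chain_space_def q_def)
  qed
  ultimately show ?r by blast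
next
  assume ?r
  then obtain p q where p: "p \<in> chain_space K n" and q: "q \<in> chain_space L (n - 1)"
    and f: "f = p + cone_op v q" by blast
  have "cone_op v q \<in> chain_space (join v K L) n"
  proof -
    have "\<sigma> \<in> join v K L \<and> int (card \<sigma>) = n" if "v \<in> \<sigma>" "q (\<sigma> - {v}) \<noteq> 0" for \<sigma>
    proof -
      have s: "\<sigma> - {v} \<in> L" "int (card (\<sigma> - {v})) = n - 1"
        using q that by (auto simp: chain_space_def)
      then have "finite (\<sigma> - {v})" using L W by (meson PowD finite_subset subsetD)
      then have "card \<sigma> = Suc (card (\<sigma> - {v}))"
        using card.remove[of \<sigma> v] that(1) by simp
      moreover have "\<sigma> \<in> insert v ` L" using s(1) that(1) by (intro image_eqI[of _ _ "\<sigma> - {v}"]) auto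
      ultimately show ?thesis using s(2) by (simp add: join_def)
    qed
    then show ?thesis by (auto simp: chain_space_def cone_op_def)
  qed
  moreover have "p \<in> chain_space (join v K L) n"
    using p by (rule chain_space_mono) (auto simp: join_def)
  ultimately show ?l using f by simp
qed

section \<open>The boundary operator on a fixed finite ground set\<close>

locale finite_vertices =
  fixes U :: "'a::linorder set"
  assumes finite_U: "finite U"
begin

text \<open>The complex does not occur: a chain vanishes off its complex, so one operator on the
  ground set \<open>U\<close> serves all complexes, and chains on different complexes can be added
  and compared.\<close>

definition bdry :: "('a set \<Rightarrow> 'k::field) \<Rightarrow> 'a set \<Rightarrow> 'k" where
  "bdry f = (\<lambda>\<sigma>. \<Sum>v\<in>U - \<sigma>. sgn_at v \<sigma> * f (insert v \<sigma>))"

definition nontrivial :: "'k::field itself \<Rightarrow> 'a set set \<Rightarrow> int \<Rightarrow> bool" where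
  "nontrivial k K n \<longleftrightarrow> (\<exists>f::'a set \<Rightarrow> 'k. f \<in> chain_space K n \<and> bdry f = 0 \<and>
     (\<forall>g\<in>chain_space K (n + 1). bdry g \<noteq> f))"

lemma bdry_arith [simp]:
  "bdry (f + g) = bdry f + bdry g"
  "bdry (f - g) = bdry f - bdry g"
  "bdry (- f) = - bdry f"
  "bdry 0 = 0"
  by (auto simp: bdry_def fun_eq_iff algebra_simps sum.distrib sum_subtractf sum_negf)

lemma avoids_bdry [simp]: "avoids v f \<Longrightarrow> avoids v (bdry f)"
  by (auto simp: avoids_def bdry_def)

text \<open>The Leibniz rule for multiplication by a vertex.\<close>

lemma bdry_cone_op:
  fixes f :: "'a set \<Rightarrow> 'k::field"
  assumes v: "v \<in> U" and f: "finitary f"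
  shows "bdry (cone_op v f) = f - cone_op v (bdry f)"
proof
  fix \<sigma>
  show "bdry (cone_op v f) \<sigma> = (f - cone_op v (bdry f)) \<sigma>"
  proof (cases "finite \<sigma>")
    case False
    then have "cone_op v f (insert u \<sigma>) = 0" "f (insert u \<sigma>) = 0" "f \<sigma> = 0" for u
      using f by (auto simp: cone_op_def finitary_def)
    moreover have "cone_op v (bdry f) \<sigma> = 0"
      using False f by (auto simp: bdry_def cone_op_def finitary_def)
    ultimately show ?thesis by (simp add: bdry_def)
  next
    case fin: True
    show ?thesis
    proof (cases "v \<in> \<sigma>")
      case False
      \<comment> \<open>The summands with u distinct from v vanish, because
        \<open>insert u \<sigma>\<close> still lacks v.\<close>
      have "bdry (cone_op v f) \<sigma> = (\<Sum>u\<in>U - \<sigma>. if u = v then f \<sigma> else 0)"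
        unfolding bdry_def cone_op_def using False by (auto simp: sgn_at_square intro!: sum.cong)
      then show ?thesis using False v finite_U by (simp add: cone_op_def)
    next
      case True
      define \<tau> where "\<tau> = \<sigma> - {v}"
      have s: "\<sigma> = insert v \<tau>" "v \<notin> \<tau>" "finite \<tau>" using True fin by (auto simp: \<tau>_def)
      have UD: "U - \<tau> = insert v (U - \<sigma>)" using s v by auto
      \<comment> \<open>Exchanging u and v negates each summand. The right-hand side yields the same
        sum: the extra summand u = v of \<open>bdry f \<tau>\<close> returns
        \<open>f \<sigma>\<close> and cancels against f.\<close>
      have "bdry (cone_op v f) \<sigma> = (\<Sum>u\<in>U - \<sigma>. - (sgn_at v \<tau> * (sgn_at u \<tau> * f (insert u \<tau>))))"
        unfolding bdry_def
      proof (rule sum.cong)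
        fix u assume u: "u \<in> U - \<sigma>"
        then have e: "insert u \<sigma> - {v} = insert u \<tau>" "v \<in> insert u \<sigma>" "u \<notin> \<tau>" "u \<noteq> v"
          using s by auto
        have "sgn_at u \<sigma> * cone_op v f (insert u \<sigma>)
            = (sgn_at u (insert v \<tau>) * sgn_at v (insert u \<tau>)) * f (insert u \<tau>)"
          using e by (simp add: cone_op_def s(1))
        also have "\<dots> = - (sgn_at v \<tau> * (sgn_at u \<tau> * f (insert u \<tau>)))"
          using e s by (subst sgn_at_swap) auto
        finally show "sgn_at u \<sigma> * cone_op v f (insert u \<sigma>)
            = - (sgn_at v \<tau> * (sgn_at u \<tau> * f (insert u \<tau>)))" .
      qed simp
      moreover have "cone_op v (bdry f) \<sigma>
          = sgn_at v \<tau> * (sgn_at v \<tau> * f \<sigma> + (\<Sum>u\<in>U - \<sigma>. sgn_at u \<tau> * f (insert u \<tau>)))"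
      proof -
        have "cone_op v (bdry f) \<sigma> = sgn_at v \<tau> * bdry f \<tau>"
          using True by (simp add: cone_op_def \<tau>_def)
        moreover have "bdry f \<tau> = sgn_at v \<tau> * f \<sigma> + (\<Sum>u\<in>U - \<sigma>. sgn_at u \<tau> * f (insert u \<tau>))"
          unfolding bdry_def UD using finite_U True by (simp add: s(1)[symmetric])
        ultimately show ?thesis by simp
      qed
      ultimately show ?thesis
        by (simp add: distrib_left sgn_at_square sum_negf sum_distrib_left)
    qed
  qed
qed

lemma nontrivial_nonneg: "nontrivial k K n \<Longrightarrow> n \<ge> 0"
proof (rule ccontr)
  assume "nontrivial k K n" "\<not> n \<ge> 0"
  then obtain f :: "'a set \<Rightarrow> 'b" where f: "f \<in> chain_space K n"
    and nb: "\<forall>g\<in>chain_space K (n + 1). bdry g \<noteq> f"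
    unfolding nontrivial_def by blast
  have "f = 0" using f \<open>\<not> n \<ge> 0\<close> by (force simp: chain_space_def fun_eq_iff)
  then show False using nb by (metis bdry_arith(4) chain_space_arith(4))
qed

text \<open>The definition tests boundaries only on faces of K of the right size. This agrees with
  equality of functions, because closure of K under subsets confines the boundary of a chain to such
  faces.\<close>

lemma homology_nonzero_iff_nontrivial:
  assumes S: "S \<subseteq> U" and K: "K \<subseteq> Pow S" and down: "\<And>\<sigma> \<tau>. \<sigma> \<in> K \<Longrightarrow> \<tau> \<subseteq> \<sigma> \<Longrightarrow> \<tau> \<in> K"
  shows "homology_nonzero k S K j \<longleftrightarrow> nontrivial k K (int j)"
proof -
  have ch: "chains K n = chain_space K (int n)" for n
    by (auto simp: chains_def chain_space_def)
  have bd: "bd S K c = bdry c" if "c \<in> chains K n" for c :: "'a set \<Rightarrow> 'b" and n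
  proof
    fix \<sigma>
    have z: "c \<tau> = 0" if "\<tau> \<notin> K" for \<tau> using \<open>c \<in> chains K n\<close> that by (auto simp: chains_def)
    have "bdry c \<sigma> = (\<Sum>v\<in>S - \<sigma>. sgn_at v \<sigma> * c (insert v \<sigma>))"
      unfolding bdry_def using S K z finite_U by (intro sum.mono_neutral_right) auto
    then show "bd S K c \<sigma> = bdry c \<sigma>"
      unfolding bd_def using z by (auto simp: sgn_at_def intro!: sum.cong)
  qed
  have supp: "\<sigma> \<in> K \<and> card \<sigma> + 1 = n" if c: "c \<in> chains K n" and nz: "bdry c \<sigma> \<noteq> 0"
    for c :: "'a set \<Rightarrow> 'b" and n \<sigma>
  proof -
    obtain v where v: "v \<in> U - \<sigma>" "c (insert v \<sigma>) \<noteq> 0"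
      using nz unfolding bdry_def by (metis (no_types, lifting) mult_zero_right sum.neutral)
    then have i: "insert v \<sigma> \<in> K" "card (insert v \<sigma>) = n" using c by (auto simp: chains_def)
    then have "finite (insert v \<sigma>)" using S K finite_U by (meson PowD finite_subset subsetD)
    then show ?thesis using i v(1) down[of "insert v \<sigma>" \<sigma>] by auto
  qed
  have cyc: "(\<forall>\<sigma>\<in>K. card \<sigma> + 1 = j \<longrightarrow> bd S K c \<sigma> = 0) \<longleftrightarrow> bdry c = 0"
    if "c \<in> chains K j" for c :: "'a set \<Rightarrow> 'b"
    using supp[OF that] bd[OF that] by (auto simp: fun_eq_iff)
  have bnd: "(\<forall>\<sigma>\<in>K. card \<sigma> = j \<longrightarrow> bd S K w \<sigma> = c \<sigma>) \<longleftrightarrow> bdry w = c"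
    if c: "c \<in> chains K j" and w: "w \<in> chains K (j + 1)" for c w :: "'a set \<Rightarrow> 'b"
  proof
    assume h: "\<forall>\<sigma>\<in>K. card \<sigma> = j \<longrightarrow> bd S K w \<sigma> = c \<sigma>"
    show "bdry w = c"
    proof
      fix \<sigma> show "bdry w \<sigma> = c \<sigma>"
      proof (cases "\<sigma> \<in> K \<and> card \<sigma> = j")
        case True
        then show ?thesis using h bd[OF w] by metis
      next
        case False
        then have "bdry w \<sigma> = 0" using supp[OF w, of \<sigma>] by auto
        moreover have "c \<sigma> = 0" using c False by (auto simp: chains_def)
        ultimately show ?thesis by simp
      qed
    qed
  qed (use bd[OF w] in auto)
  have ch1: "chains K (j + 1) = chain_space K (int j + 1)" by (simp add: ch add.commute)
  show ?thesis
    unfolding homology_nonzero_def nontrivial_def ch1[symmetric] ch[symmetric]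
    using cyc bnd by blast
qed

lemma bdry_split:
  assumes "v \<in> U" "finitary q"
  shows "bdry (p + cone_op v q) = (bdry p + q) + cone_op v (- bdry q)"
  using assms by (simp add: bdry_cone_op)

section \<open>Gluing a cone onto a complex\<close>

text \<open>The relevant part of the exact sequence H(K) -> H(K with a cone over L) -> H(L).\<close>

lemma nontrivial_join:
  assumes LK: "L \<subseteq> K" and KW: "K \<subseteq> Pow W" and W: "W \<subseteq> U" "v \<in> U" "v \<notin> W"
    and nt: "nontrivial k (join v K L) n"
  shows "nontrivial k K n \<or> nontrivial k L (n - 1)"
proof (rule ccontr)
  assume no: "\<not> ?thesis"
  have fW: "finite W" using W finite_U by (auto dest: finite_subset)
  have LW: "L \<subseteq> Pow W" using LK KW by blast
  note split = chain_space_join[OF KW LW W(3) fW]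
  obtain f :: "'a set \<Rightarrow> 'b" where f: "f \<in> chain_space (join v K L) n" and c: "bdry f = 0"
    and nb: "\<forall>g\<in>chain_space (join v K L) (n + 1). bdry g \<noteq> f"
    using nt unfolding nontrivial_def by blast
  from f split obtain p q where p: "p \<in> chain_space K n" and q: "q \<in> chain_space L (n - 1)"
    and fe: "f = p + cone_op v q" by blast
  note av = avoids_chain[OF _ KW W(3)] avoids_chain[OF _ LW W(3)]
  note fn = finitary_chain[OF _ KW fW] finitary_chain[OF _ LW fW]
  have "bdry p + q = 0 \<and> - bdry q = 0"
    using c unfolding fe bdry_split[OF W(2) fn(2)[OF q]]
    by (rule split_unique) (use p q in \<open>auto simp: av\<close>)
  then have e: "bdry p + q = 0" "bdry q = 0" by auto
  \<comment> \<open>The connecting map sends the class of f to that of q. A filling g of q in L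
    makes p + g a cycle on K, and a filling h of that gives the filling h - v g of f.\<close>
  obtain g where g: "g \<in> chain_space L n" "bdry g = q"
    using no q e(2) unfolding nontrivial_def by force
  have gK: "g \<in> chain_space K n" using g(1) LK by (rule chain_space_mono)
  have "bdry (p + g) = 0" using e(1) g(2) by simp
  moreover have "p + g \<in> chain_space K n" using p gK by simp
  ultimately obtain h where h: "h \<in> chain_space K (n + 1)" "bdry h = p + g"
    using no unfolding nontrivial_def by blast
  have "h + cone_op v (- g) \<in> chain_space (join v K L) (n + 1)"
    unfolding split using h(1) g(1) by (intro bexI[of _ h] bexI[of _ "- g"]) auto
  moreover have "bdry (h + cone_op v (- g)) = f"
    using g h by (simp add: bdry_cone_op W fn fe)
  ultimately show False using nb by blast
qed

text \<open>A cone is acyclic: a cycle p + v q has q = - dp, so the Leibniz rule makes v p a filling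
  of it.\<close>

lemma cone_not_nontrivial:
  assumes KW: "K \<subseteq> Pow W" and W: "W \<subseteq> U" "v \<in> U" "v \<notin> W"
  shows "\<not> nontrivial k (join v K K) n"
proof
  assume nt: "nontrivial k (join v K K) n"
  have fW: "finite W" using W finite_U by (auto dest: finite_subset)
  note split = chain_space_join[OF KW KW W(3) fW]
  obtain f :: "'a set \<Rightarrow> 'b" where f: "f \<in> chain_space (join v K K) n" and c: "bdry f = 0"
    and nb: "\<forall>g\<in>chain_space (join v K K) (n + 1). bdry g \<noteq> f"
    using nt unfolding nontrivial_def by blast
  from f split obtain p q where p: "p \<in> chain_space K n" and q: "q \<in> chain_space K (n - 1)"
    and fe: "f = p + cone_op v q" by blast
  note av = avoids_chain[OF _ KW W(3)]
  note fn = finitary_chain[OF _ KW fW]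
  have "bdry p + q = 0 \<and> - bdry q = 0"
    using c unfolding fe bdry_split[OF W(2) fn[OF q]]
    by (rule split_unique) (use p q in \<open>auto simp: av\<close>)
  then have e: "q = - bdry p" by (metis add.inverse_unique)
  have "0 + cone_op v p \<in> chain_space (join v K K) (n + 1)"
    unfolding split using p by (intro bexI[of _ 0] bexI[of _ p]) auto
  moreover have "bdry (0 + cone_op v p) = f"
    by (simp add: bdry_cone_op W fn[OF p] fe e)
  ultimately show False using nb by blast
qed

text \<open>The equations for p + v q to be a cycle or a boundary involve only p and q, so the apex
  can be renamed without regard to its position in the vertex order. This lets y take the place of
  x.\<close>

lemma nontrivial_change_apex:
  assumes KW: "K \<subseteq> Pow W" and LW: "L \<subseteq> Pow W" and W: "W \<subseteq> U"
    and v: "v \<in> U" "v \<notin> W" and u: "u \<in> U" "u \<notin> W"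
    and nt: "nontrivial k (join v K L) n"
  shows "nontrivial k (join u K L) n"
proof -
  have fW: "finite W" using W finite_U by (auto dest: finite_subset)
  note splitv = chain_space_join[OF KW LW v(2) fW]
  note splitu = chain_space_join[OF KW LW u(2) fW]
  obtain f :: "'a set \<Rightarrow> 'b" where f: "f \<in> chain_space (join v K L) n" and c: "bdry f = 0"
    and nb: "\<forall>g\<in>chain_space (join v K L) (n + 1). bdry g \<noteq> f"
    using nt unfolding nontrivial_def by blast
  from f splitv obtain p q where p: "p \<in> chain_space K n" and q: "q \<in> chain_space L (n - 1)"
    and fe: "f = p + cone_op v q" by blast
  note av = avoids_chain[OF _ KW v(2)] avoids_chain[OF _ LW v(2)]
    avoids_chain[OF _ KW u(2)] avoids_chain[OF _ LW u(2)]
  note fn = finitary_chain[OF _ KW fW] finitary_chain[OF _ LW fW]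
  have "bdry p + q = 0 \<and> - bdry q = 0"
    using c unfolding fe bdry_split[OF v(1) fn(2)[OF q]]
    by (rule split_unique) (use p q in \<open>auto simp: av\<close>)
  then have e: "bdry p + q = 0" "bdry q = 0" by auto
  define f' where "f' = p + cone_op u q"
  have "f' \<in> chain_space (join u K L) n" unfolding splitu f'_def using p q by blast
  moreover have "bdry f' = 0" using e q by (simp add: f'_def bdry_cone_op u fn)
  moreover have "bdry g \<noteq> f'" if g: "g \<in> chain_space (join u K L) (n + 1)" for g
  proof
    assume b: "bdry g = f'"
    obtain r s where r: "r \<in> chain_space K (n + 1)" and s: "s \<in> chain_space L n"
      and ge: "g = r + cone_op u s"
      using g splitu[of g "n + 1"] by auto
    have "bdry r + s = p \<and> - bdry s = q"
      using b unfolding ge f'_def bdry_split[OF u(1) fn(2)[OF s]]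
      by (rule split_unique') (use p q r s in \<open>auto simp: av\<close>)
    then have "bdry (r + cone_op v s) = f"
      using s by (auto simp: bdry_cone_op v fn fe algebra_simps)
    moreover have "r + cone_op v s \<in> chain_space (join v K L) (n + 1)"
      unfolding splitv using r s by auto
    ultimately show False using nb by blast
  qed
  ultimately show ?thesis unfolding nontrivial_def by blast
qed

end

section \<open>The Lozin transform suspends\<close>

text \<open>The coefficients of a chain on the independence complex of a Lozin transform, one for each
  independent subset of the path y, a, b, z.\<close>

definition lozin_chain ::
  "'a::linorder \<Rightarrow> 'a \<Rightarrow> 'a \<Rightarrow> 'a \<Rightarrow> ('a set \<Rightarrow> 'k::field) \<Rightarrow> ('a set \<Rightarrow> 'k) \<Rightarrow> ('a set \<Rightarrow> 'k) \<Rightarrow>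
    ('a set \<Rightarrow> 'k) \<Rightarrow> ('a set \<Rightarrow> 'k) \<Rightarrow> ('a set \<Rightarrow> 'k) \<Rightarrow> ('a set \<Rightarrow> 'k) \<Rightarrow> ('a set \<Rightarrow> 'k) \<Rightarrow> 'a set \<Rightarrow> 'k"
where
  "lozin_chain y a b z w wy wa wb wz wby wyz waz =
     w + cone_op z wz + cone_op y (wy + cone_op z wyz) + cone_op a (wa + cone_op z waz)
       + cone_op b (wb + cone_op y wby)"

text \<open>The independence complex after adding z, y, a, b in this order, with A, AY, AZ the
  complexes on the old vertices, on those not adjacent to y, and on those not adjacent to z. The
  second argument of each \<open>join\<close> is the link of the vertex being added; the nesting is
  that of \<open>lozin_chain\<close>.\<close>

definition lozin_complex ::
  "'a \<Rightarrow> 'a \<Rightarrow> 'a \<Rightarrow> 'a \<Rightarrow> 'a set set \<Rightarrow> 'a set set \<Rightarrow> 'a set set \<Rightarrow> 'a set set" where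
  "lozin_complex y a b z A AY AZ =
     join b (join a (join y (join z A AZ) (join z AY (AY \<inter> AZ))) (join z A AZ)) (join y A AY)"

lemma join_Pow: "K \<subseteq> Pow W \<Longrightarrow> L \<subseteq> Pow W \<Longrightarrow> join v K L \<subseteq> Pow (insert v W)"
  by (auto simp: join_def)

text \<open>\<open>chain_space_join\<close> applied at b, a, y and z. A coefficient behind i path
  vertices has its degree lowered by i and lives on the common link of these vertices.\<close>

lemma chain_space_lozin_complex:
  assumes A: "A \<subseteq> Pow W" and AY: "AY \<subseteq> A" and AZ: "AZ \<subseteq> A" and W: "finite W"
    and out: "y \<notin> W" "a \<notin> W" "b \<notin> W" "z \<notin> W" and d: "distinct [y, a, b, z]"
  shows "f \<in> chain_space (lozin_complex y a b z A AY AZ) n \<longleftrightarrow>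
    (\<exists>w wy wa wb wz wby wyz waz. w \<in> chain_space A n \<and> wy \<in> chain_space AY (n - 1) \<and>
      wa \<in> chain_space A (n - 1) \<and> wb \<in> chain_space A (n - 1) \<and> wz \<in> chain_space AZ (n - 1) \<and>
      wby \<in> chain_space AY (n - 2) \<and> wyz \<in> chain_space (AY \<inter> AZ) (n - 2) \<and>
      waz \<in> chain_space AZ (n - 2) \<and> f = lozin_chain y a b z w wy wa wb wz wby wyz waz)"
proof -
  have P: "AY \<subseteq> Pow W" "AZ \<subseteq> Pow W" "AY \<inter> AZ \<subseteq> Pow W" using A AY AZ by auto
  have P1: "join z A AZ \<subseteq> Pow (insert z W)" "join z AY (AY \<inter> AZ) \<subseteq> Pow (insert z W)"
    using join_Pow[OF A P(2)] join_Pow[OF P(1) P(3)] by auto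
  have P2: "join y (join z A AZ) (join z AY (AY \<inter> AZ)) \<subseteq> Pow (insert y (insert z W))"
    "join z A AZ \<subseteq> Pow (insert y (insert z W))"
    using join_Pow[OF P1] P1(1) by auto
  have P3: "join a (join y (join z A AZ) (join z AY (AY \<inter> AZ))) (join z A AZ)
      \<subseteq> Pow (insert a (insert y (insert z W)))"
    using join_Pow[OF P2] .
  have P4: "join y A AY \<subseteq> Pow (insert y W)" using join_Pow[OF A P(1)] .
  then have P4: "join y A AY \<subseteq> Pow (insert a (insert y (insert z W)))" by auto
  have sb: "f \<in> chain_space (lozin_complex y a b z A AY AZ) m \<longleftrightarrow>
      (\<exists>p\<in>chain_space (join a (join y (join z A AZ) (join z AY (AY \<inter> AZ))) (join z A AZ)) m.
       \<exists>q\<in>chain_space (join y A AY) (m - 1). f = p + cone_op b q)" for f :: "'a set \<Rightarrow> 'k::field" and m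
    unfolding lozin_complex_def by (rule chain_space_join[OF P3 P4]) (use out d W in auto)
  have sa: "f \<in> chain_space (join a (join y (join z A AZ) (join z AY (AY \<inter> AZ))) (join z A AZ)) m \<longleftrightarrow>
      (\<exists>p\<in>chain_space (join y (join z A AZ) (join z AY (AY \<inter> AZ))) m.
       \<exists>q\<in>chain_space (join z A AZ) (m - 1). f = p + cone_op a q)" for f :: "'a set \<Rightarrow> 'k::field" and m
    by (rule chain_space_join[OF P2]) (use out d W in auto)
  have sy: "f \<in> chain_space (join y (join z A AZ) (join z AY (AY \<inter> AZ))) m \<longleftrightarrow>
      (\<exists>p\<in>chain_space (join z A AZ) m. \<exists>q\<in>chain_space (join z AY (AY \<inter> AZ)) (m - 1).
       f = p + cone_op y q)" for f :: "'a set \<Rightarrow> 'k::field" and m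
    by (rule chain_space_join[OF P1]) (use out d W in auto)
  note s = chain_space_join[OF A P(2) out(4) W] chain_space_join[OF P(1) P(3) out(4) W]
    chain_space_join[OF A P(1) out(1) W]
  show ?thesis
  proof
    assume "f \<in> chain_space (lozin_complex y a b z A AY AZ) n"
    then obtain p q where p: "p \<in> chain_space (join a (join y (join z A AZ) (join z AY (AY \<inter> AZ))) (join z A AZ)) n"
      and q: "q \<in> chain_space (join y A AY) (n - 1)" and f: "f = p + cone_op b q"
      using sb by blast
    obtain p' r where p': "p' \<in> chain_space (join y (join z A AZ) (join z AY (AY \<inter> AZ))) n"
      and r: "r \<in> chain_space (join z A AZ) (n - 1)" and pe: "p = p' + cone_op a r"
      using p sa by blast
    obtain p'' t where p'': "p'' \<in> chain_space (join z A AZ) n"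
      and t: "t \<in> chain_space (join z AY (AY \<inter> AZ)) (n - 1)" and pe': "p' = p'' + cone_op y t"
      using p' sy by blast
    have n: "n - 1 - 1 = n - 2" by simp
    obtain wb wby where c1: "wb \<in> chain_space A (n - 1)" "wby \<in> chain_space AY (n - 2)"
      "q = wb + cone_op y wby"
      using q unfolding s n by blast
    obtain wa waz where c2: "wa \<in> chain_space A (n - 1)" "waz \<in> chain_space AZ (n - 2)"
      "r = wa + cone_op z waz"
      using r unfolding s n by blast
    obtain wy wyz where c3: "wy \<in> chain_space AY (n - 1)" "wyz \<in> chain_space (AY \<inter> AZ) (n - 2)"
      "t = wy + cone_op z wyz"
      using t unfolding s n by blast
    obtain w wz where c4: "w \<in> chain_space A n" "wz \<in> chain_space AZ (n - 1)"
      "p'' = w + cone_op z wz"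
      using p'' unfolding s by blast
    note c = c1(1,2) c2(1,2) c3(1,2) c4(1,2)
    note e = pe pe' c1(3) c2(3) c3(3) c4(3)
    have "f = lozin_chain y a b z w wy wa wb wz wby wyz waz" by (simp only: f e lozin_chain_def)
    with c show "\<exists>w wy wa wb wz wby wyz waz. w \<in> chain_space A n \<and> wy \<in> chain_space AY (n - 1) \<and>
      wa \<in> chain_space A (n - 1) \<and> wb \<in> chain_space A (n - 1) \<and> wz \<in> chain_space AZ (n - 1) \<and>
      wby \<in> chain_space AY (n - 2) \<and> wyz \<in> chain_space (AY \<inter> AZ) (n - 2) \<and>
      waz \<in> chain_space AZ (n - 2) \<and> f = lozin_chain y a b z w wy wa wb wz wby wyz waz"
      by - (rule exI[of _ w], rule exI[of _ wy], rule exI[of _ wa], rule exI[of _ wb], rule exI[of _ wz],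
          rule exI[of _ wby], rule exI[of _ wyz], rule exI[of _ waz], simp)
  next
    assume "\<exists>w wy wa wb wz wby wyz waz. w \<in> chain_space A n \<and> wy \<in> chain_space AY (n - 1) \<and>
      wa \<in> chain_space A (n - 1) \<and> wb \<in> chain_space A (n - 1) \<and> wz \<in> chain_space AZ (n - 1) \<and>
      wby \<in> chain_space AY (n - 2) \<and> wyz \<in> chain_space (AY \<inter> AZ) (n - 2) \<and>
      waz \<in> chain_space AZ (n - 2) \<and> f = lozin_chain y a b z w wy wa wb wz wby wyz waz"
    then obtain w wy wa wb wz wby wyz waz where
      c: "w \<in> chain_space A n" "wy \<in> chain_space AY (n - 1)"
      "wa \<in> chain_space A (n - 1)" "wb \<in> chain_space A (n - 1)" "wz \<in> chain_space AZ (n - 1)"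
      "wby \<in> chain_space AY (n - 1 - 1)" "wyz \<in> chain_space (AY \<inter> AZ) (n - 1 - 1)"
      "waz \<in> chain_space AZ (n - 1 - 1)"
      and f: "f = lozin_chain y a b z w wy wa wb wz wby wyz waz"
      by auto
    have "w + cone_op z wz \<in> chain_space (join z A AZ) n"
      "wy + cone_op z wyz \<in> chain_space (join z AY (AY \<inter> AZ)) (n - 1)"
      "wa + cone_op z waz \<in> chain_space (join z A AZ) (n - 1)"
      "wb + cone_op y wby \<in> chain_space (join y A AY) (n - 1)"
      unfolding s using c by blast+
    then have "w + cone_op z wz + cone_op y (wy + cone_op z wyz)
        \<in> chain_space (join y (join z A AZ) (join z AY (AY \<inter> AZ))) n"
      and az: "wa + cone_op z waz \<in> chain_space (join z A AZ) (n - 1)"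
      and yb: "wb + cone_op y wby \<in> chain_space (join y A AY) (n - 1)"
      unfolding sy by blast+
    then have "w + cone_op z wz + cone_op y (wy + cone_op z wyz) + cone_op a (wa + cone_op z waz)
        \<in> chain_space (join a (join y (join z A AZ) (join z AY (AY \<inter> AZ))) (join z A AZ)) n"
      unfolding sa by blast
    then show "f \<in> chain_space (lozin_complex y a b z A AY AZ) n"
      unfolding sb f lozin_chain_def using yb by blast
  qed
qed

lemma lozin_chain_unique:
  assumes "lozin_chain y a b z w wy wa wb wz wby wyz waz = lozin_chain y a b z v vy va vb vz vby vyz vaz"
    and avoid: "\<forall>u\<in>{y, a, b, z}.
      \<forall>f\<in>{w, wy, wa, wb, wz, wby, wyz, waz, v, vy, va, vb, vz, vby, vyz, vaz}. avoids u f"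
    and d: "distinct [y, a, b, z]"
  shows "w = v" "wy = vy" "wa = va" "wb = vb" "wz = vz" "wby = vby" "wyz = vyz" "waz = vaz"
proof -
  have av:
    "\<And>u. u \<in> {y, a, b, z} \<Longrightarrow> avoids u w \<and> avoids u wy \<and> avoids u wa \<and> avoids u wb \<and> avoids u wz \<and>
      avoids u wby \<and> avoids u wyz \<and> avoids u waz"
    "\<And>u. u \<in> {y, a, b, z} \<Longrightarrow> avoids u v \<and> avoids u vy \<and> avoids u va \<and> avoids u vb \<and> avoids u vz \<and>
      avoids u vby \<and> avoids u vyz \<and> avoids u vaz"
    using avoid by blast+
  note d = d d[THEN distinct_rev[THEN iffD2]]
  note av = av[of y, simplified] av[of a, simplified] av[of b, simplified] av[of z, simplified]
  have 1: "w + cone_op z wz + cone_op y (wy + cone_op z wyz) + cone_op a (wa + cone_op z waz)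
    = v + cone_op z vz + cone_op y (vy + cone_op z vyz) + cone_op a (va + cone_op z vaz) \<and>
    wb + cone_op y wby = vb + cone_op y vby"
    using assms(1) unfolding lozin_chain_def by (rule split_unique') (use av d in simp_all)
  have 2: "w + cone_op z wz + cone_op y (wy + cone_op z wyz)
    = v + cone_op z vz + cone_op y (vy + cone_op z vyz) \<and> wa + cone_op z waz = va + cone_op z vaz"
    by (rule split_unique'[OF conjunct1[OF 1]]) (use av d in simp_all)
  have 3: "w + cone_op z wz = v + cone_op z vz \<and> wy + cone_op z wyz = vy + cone_op z vyz"
    by (rule split_unique'[OF conjunct1[OF 2]]) (use av d in simp_all)
  have 4: "wb = vb \<and> wby = vby"
    by (rule split_unique'[OF conjunct2[OF 1]]) (use av d in simp_all)
  have 5: "wa = va \<and> waz = vaz"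
    by (rule split_unique'[OF conjunct2[OF 2]]) (use av d in simp_all)
  have 6: "w = v \<and> wz = vz"
    by (rule split_unique'[OF conjunct1[OF 3]]) (use av d in simp_all)
  have 7: "wy = vy \<and> wyz = vyz"
    by (rule split_unique'[OF conjunct2[OF 3]]) (use av d in simp_all)
  from 4 5 6 7 show "w = v" "wy = vy" "wa = va" "wb = vb" "wz = vz" "wby = vby" "wyz = vyz" "waz = vaz"
    by auto
qed

lemma lozin_chain_zero: "lozin_chain y a b z 0 0 0 0 0 0 0 0 = 0"
  by (simp add: lozin_chain_def)

context finite_vertices
begin

text \<open>The Leibniz rule used twice, for instance d(by s) = y s - b s + by ds: a coefficient
  behind two path vertices reaches the inner one with sign + and the outer one with sign -.\<close>

lemma bdry_lozin_chain:
  assumes "\<forall>f\<in>{w, wy, wa, wb, wz, wby, wyz, waz}. finitary f"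
    and "y \<in> U" "a \<in> U" "b \<in> U" "z \<in> U"
  shows "bdry (lozin_chain y a b z w wy wa wb wz wby wyz waz) =
    lozin_chain y a b z (bdry w + wy + wa + wb + wz) (- bdry wy + wby - wyz) (- bdry wa - waz)
      (- bdry wb - wby) (- bdry wz + wyz + waz) (bdry wby) (bdry wyz) (bdry waz)"
  using assms by (simp add: lozin_chain_def bdry_cone_op algebra_simps)

text \<open>The chain map sending c + x c' to (a - b) c - (by + yz - az) c' induces the isomorphism: up to
  sign it is a section of the chain map with a s |-> s, z s |-> s, yz s |-> -x s (all other
  types of faces map to 0), and it is a homotopy inverse through the homotopy
  s |-> b s, y s |-> by s, z s |-> az s.\<close>

lemma nontrivial_lozin_complex:
  assumes A: "A \<subseteq> Pow W" and AY: "AY \<subseteq> A" and AZ: "AZ \<subseteq> A" and WU: "W \<subseteq> U"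
    and inU: "x \<in> U" "y \<in> U" "a \<in> U" "b \<in> U" "z \<in> U"
    and x: "x \<notin> W" and out: "y \<notin> W" "a \<notin> W" "b \<notin> W" "z \<notin> W" and d: "distinct [y, a, b, z]"
  shows "nontrivial k (lozin_complex y a b z A AY AZ) (n + 1) \<longleftrightarrow> nontrivial k (join x A (AY \<inter> AZ)) n"
    (is "nontrivial k ?L _ \<longleftrightarrow> nontrivial k ?G _")
proof -
  have W: "finite W" using WU finite_U by (rule finite_subset)
  have P: "AY \<subseteq> Pow W" "AZ \<subseteq> Pow W" "AY \<inter> AZ \<subseteq> Pow W" using A AY AZ by auto
  note splitL = chain_space_lozin_complex[OF A AY AZ W out d]
  note splitG = chain_space_join[OF A P(3) x W]
  \<comment> \<open>Chains on W of any degree, closed under arithmetic: one membership provides the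
    finiteness and avoidance conditions of all splitting lemmas.\<close>
  define B :: "('a set \<Rightarrow> 'b) set" where "B = {f. finitary f \<and> (\<forall>u. u \<notin> W \<longrightarrow> avoids u f)}"
  have B: "f \<in> B" if "f \<in> chain_space A m \<or> f \<in> chain_space AY m \<or> f \<in> chain_space AZ m \<or>
    f \<in> chain_space (AY \<inter> AZ) m" for f m
    using that P A W unfolding B_def by (auto intro: finitary_chain avoids_chain)
  have Ba: "f + g \<in> B" "f - g \<in> B" "- f \<in> B" if "f \<in> B" "g \<in> B" for f g
    using that by (auto simp: B_def)
  have B0: "0 \<in> B" by (simp add: B_def)
  have fin: "finitary f" if "f \<in> B" for f using that by (simp add: B_def)
  have av: "avoids u f" if "f \<in> B" "u \<notin> W" for u f using that by (simp add: B_def)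
  have bav: "avoids u (bdry f)" if "f \<in> B" "u \<notin> W" for u f using that by (simp add: B_def)
  have subA: "f \<in> chain_space A m" if "f \<in> chain_space AZ m" for f :: "'a set \<Rightarrow> 'b" and m
    using that AZ by (rule chain_space_mono)
  have subY: "f \<in> chain_space AY m" and subZ: "f \<in> chain_space AZ m"
    if "f \<in> chain_space (AY \<inter> AZ) m" for f :: "'a set \<Rightarrow> 'b" and m
    using that by (auto intro: chain_space_mono)
  have bdryG: "bdry (p + cone_op x q) = (bdry p + q) + cone_op x (- bdry q)" if "p \<in> B" "q \<in> B" for p q
    using that inU by (simp add: bdry_cone_op fin)
  show ?thesis
  proof
    assume "nontrivial k ?L (n + 1)"
    then obtain f :: "'a set \<Rightarrow> 'b" where f: "f \<in> chain_space ?L (n + 1)" and c: "bdry f = 0"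
      and nb: "\<forall>g\<in>chain_space ?L (n + 2). bdry g \<noteq> f"
      unfolding nontrivial_def by (auto simp: add.assoc)
    obtain w wy wa wb wz wby wyz waz where
      C: "w \<in> chain_space A (n + 1)" "wy \<in> chain_space AY n" "wa \<in> chain_space A n"
      "wb \<in> chain_space A n" "wz \<in> chain_space AZ n" "wby \<in> chain_space AY (n - 1)"
      "wyz \<in> chain_space (AY \<inter> AZ) (n - 1)" "waz \<in> chain_space AZ (n - 1)"
      and fe: "f = lozin_chain y a b z w wy wa wb wz wby wyz waz"
      using f splitL[of f "n + 1"] by auto
    have BB: "w \<in> B" "wy \<in> B" "wa \<in> B" "wb \<in> B" "wz \<in> B" "wby \<in> B" "wyz \<in> B" "waz \<in> B"
      using C B by blast+
    have "lozin_chain y a b z (bdry w + wy + wa + wb + wz) (- bdry wy + wby - wyz) (- bdry wa - waz)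
      (- bdry wb - wby) (- bdry wz + wyz + waz) (bdry wby) (bdry wyz) (bdry waz)
      = lozin_chain y a b z 0 0 0 0 0 0 0 0"
      using c BB inU unfolding fe lozin_chain_zero by (subst (asm) bdry_lozin_chain) (auto simp: fin)
    note eq = lozin_chain_unique[OF this _ d]
    have e: "bdry w + wy + wa + wb + wz = 0" "- bdry wy + wby - wyz = 0" "- bdry wa - waz = 0"
      "- bdry wb - wby = 0" "- bdry wz + wyz + waz = 0" "bdry wby = 0" "bdry wyz = 0" "bdry waz = 0"
      by (rule eq; use BB out in \<open>auto simp: av bav\<close>)+
    \<comment> \<open>The image of f under the map a s |-> s, z s |-> s, yz s |-> - x s. It is a
      cycle since its boundary consists of the a, z and yz components of df, up to sign.\<close>
    define g where "g = (wa + wz) + cone_op x (- wyz)"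
    have "g \<in> chain_space ?G n"
      unfolding splitG g_def using C subA by (intro bexI[of _ "wa + wz"] bexI[of _ "- wyz"]) auto
    moreover have "bdry g = 0"
    proof -
      have "bdry g = (bdry wa + bdry wz - wyz) + cone_op x (bdry wyz)"
        unfolding g_def using BB Ba by (subst bdryG) auto
      moreover have "bdry wa + bdry wz - wyz = - (- bdry wa - waz) - (- bdry wz + wyz + waz)"
        by (simp add: algebra_simps)
      ultimately show ?thesis by (simp only: e cone_op_zero diff_zero add_0 minus_zero)
    qed
    moreover have "bdry h \<noteq> g" if h: "h \<in> chain_space ?G (n + 1)" for h
    proof
      assume bh: "bdry h = g"
      obtain u v where C': "u \<in> chain_space A (n + 1)" "v \<in> chain_space (AY \<inter> AZ) n"
        and he: "h = u + cone_op x v" using h splitG[of h "n + 1"] by auto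
      have BB': "u \<in> B" "v \<in> B" using C' B by blast+
      have "bdry u + v = wa + wz \<and> - bdry v = - wyz"
        using bh unfolding he g_def bdryG[OF BB']
        by (rule split_unique') (use BB BB' x in \<open>auto simp: av bav\<close>)
      then have e': "wa = bdry u + v - wz" "wyz = bdry v" by (auto simp: algebra_simps)
      \<comment> \<open>The homotopy applied to f, which is b w + by wy + az wz, minus the section
        applied to h. The section anticommutes with the boundary, so the second part contributes the
        section of g, which is what the boundary of the first part lacks to be f.\<close>
      define F where "F = lozin_chain y a b z 0 0 (- u) (w + u) 0 (wy + v) v (wz - v)"
      have "F \<in> chain_space ?L (n + 2)"
        unfolding splitL F_def
        by (intro exI conjI, rule_tac [9] refl) (use C C' subY subZ in \<open>auto simp: add.commute[of 1 n]\<close>)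
      moreover have "bdry F = f"
      proof -
        have E: "bdry 0 + 0 + - u + (w + u) + 0 = w" "- bdry 0 + (wy + v) - v = wy"
          "- bdry (- u) - (wz - v) = wa" "- bdry 0 + v + (wz - v) = wz" "bdry v = wyz"
          by (simp_all add: e' algebra_simps)
        \<comment> \<open>The b component is the one that needs the cycle equation on faces without
          path vertices, \<open>e(1)\<close>.\<close>
        have E': "- bdry (w + u) - (wy + v) = wb"
        proof -
          have "wb = (bdry w + wy + wa + wb + wz) - (bdry w + wy + wa + wz)" by simp
          also have "\<dots> = - bdry (w + u) - (wy + v)" unfolding e(1) by (simp add: e' algebra_simps)
          finally show ?thesis by simp
        qed
        have E'': "bdry (wy + v) = wby" "bdry (wz - v) = waz"
          using e(2,5) e'(2) by (simp_all add: algebra_simps)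
        have "bdry F = lozin_chain y a b z (bdry 0 + 0 + - u + (w + u) + 0) (- bdry 0 + (wy + v) - v)
            (- bdry (- u) - (wz - v)) (- bdry (w + u) - (wy + v)) (- bdry 0 + v + (wz - v))
            (bdry (wy + v)) (bdry v) (bdry (wz - v))"
          unfolding F_def by (rule bdry_lozin_chain) (use BB BB' inU in \<open>auto simp: fin\<close>)
        then show ?thesis unfolding E E' E'' fe .
      qed
      ultimately show False using nb by blast
    qed
    ultimately show "nontrivial k ?G n" unfolding nontrivial_def by blast
  next
    assume "nontrivial k ?G n"
    then obtain g :: "'a set \<Rightarrow> 'b" where g: "g \<in> chain_space ?G n" and c: "bdry g = 0"
      and nb: "\<forall>h\<in>chain_space ?G (n + 1). bdry h \<noteq> g"
      unfolding nontrivial_def by blast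
    obtain u v where C: "u \<in> chain_space A n" "v \<in> chain_space (AY \<inter> AZ) (n - 1)"
      and ge: "g = u + cone_op x v" using g splitG[of g n] by auto
    have BB: "u \<in> B" "v \<in> B" using C B by blast+
    have "bdry u + v = 0 \<and> - bdry v = 0"
      using c unfolding ge bdryG[OF BB]
      by (rule split_unique) (use BB x in \<open>auto simp: av bav\<close>)
    then have e: "v = - bdry u" "bdry v = 0" by (auto simp: eq_neg_iff_add_eq_0 add.commute)
    \<comment> \<open>The section applied to g. As v lives on both AY and AZ, it may stand behind
      by, yz and az.\<close>
    define f where "f = lozin_chain y a b z 0 0 u (- u) 0 (- v) (- v) v"
    have "f \<in> chain_space ?L (n + 1)"
      unfolding splitL f_def
      by (intro exI conjI, rule_tac [9] refl) (use C subY subZ in auto)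
    moreover have "bdry f = 0"
    proof -
      have E: "bdry 0 + 0 + u + - u + 0 = 0" "- bdry 0 + - v - - v = 0" "- bdry u - v = 0"
        "- bdry (- u) - - v = 0" "- bdry 0 + - v + v = 0" "bdry (- v) = 0"
        using e by simp_all
      have "bdry f = lozin_chain y a b z (bdry 0 + 0 + u + - u + 0) (- bdry 0 + - v - - v)
          (- bdry u - v) (- bdry (- u) - - v) (- bdry 0 + - v + v) (bdry (- v)) (bdry (- v)) (bdry v)"
        unfolding f_def by (rule bdry_lozin_chain) (use BB inU in \<open>auto simp: fin\<close>)
      then show ?thesis unfolding E e(2) lozin_chain_zero .
    qed
    moreover have "bdry F \<noteq> f" if F: "F \<in> chain_space ?L (n + 1 + 1)" for F
    proof
      assume bF: "bdry F = f"
      obtain w wy wa wb wz wby wyz waz where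
        C': "w \<in> chain_space A (n + 2)" "wy \<in> chain_space AY (n + 1)" "wa \<in> chain_space A (n + 1)"
        "wb \<in> chain_space A (n + 1)" "wz \<in> chain_space AZ (n + 1)" "wby \<in> chain_space AY n"
        "wyz \<in> chain_space (AY \<inter> AZ) n" "waz \<in> chain_space AZ n"
        and Fe: "F = lozin_chain y a b z w wy wa wb wz wby wyz waz"
        using F splitL[of F "n + 2"] by (auto simp: add.assoc add.commute[of 1 n])
      have BB': "w \<in> B" "wy \<in> B" "wa \<in> B" "wb \<in> B" "wz \<in> B" "wby \<in> B" "wyz \<in> B" "waz \<in> B"
        using C' B by blast+
      have "lozin_chain y a b z (bdry w + wy + wa + wb + wz) (- bdry wy + wby - wyz) (- bdry wa - waz)
        (- bdry wb - wby) (- bdry wz + wyz + waz) (bdry wby) (bdry wyz) (bdry waz)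
        = lozin_chain y a b z 0 0 u (- u) 0 (- v) (- v) v"
        using bF BB' inU unfolding Fe f_def by (subst (asm) bdry_lozin_chain) (auto simp: fin)
      note eq = lozin_chain_unique[OF this _ d]
      have e': "- bdry wa - waz = u" "- bdry wz + wyz + waz = 0" "bdry wyz = - v"
        by (rule eq; use BB BB' B0 out in \<open>auto simp: av bav\<close>)+
      \<comment> \<open>Minus the image of F under the map to chains on G; the minus sign
        compensates that this map anticommutes with the boundary.\<close>
      define h where "h = (- wa - wz) + cone_op x wyz"
      have "h \<in> chain_space ?G (n + 1)"
        unfolding splitG h_def using C' subA by (intro bexI[of _ "- wa - wz"] bexI[of _ wyz]) auto
      moreover have "bdry h = g"
      proof -
        have "bdry h = (- bdry wa - bdry wz + wyz) + cone_op x (- bdry wyz)"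
          unfolding h_def using BB' Ba by (subst bdryG) auto
        moreover have "- bdry wa - bdry wz + wyz = (- bdry wa - waz) + (- bdry wz + wyz + waz)"
          by (simp add: algebra_simps)
        ultimately show ?thesis by (simp only: e' ge minus_minus add_0_right)
      qed
      ultimately show False using nb by blast
    qed
    ultimately show "nontrivial k ?L (n + 1)" unfolding nontrivial_def by blast
  qed
qed

end

section \<open>Independence complexes\<close>

text \<open>The vertex set is left open, so that one edge set can be used with every set of
  vertices.\<close>

definition two_edges :: "'a set set \<Rightarrow> bool" where
  "two_edges E \<longleftrightarrow> (\<forall>e\<in>E. \<exists>u w. u \<noteq> w \<and> e = {u, w})"

lemma ind_complex_Pow: "ind_complex S E \<subseteq> Pow S"
  by (auto simp: ind_complex_def)

lemma ind_complex_Int: "ind_complex S E \<inter> ind_complex T E = ind_complex (S \<inter> T) E"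
  by (auto simp: ind_complex_def)

lemma ind_complex_cong:
  assumes "\<And>e. e \<subseteq> S \<Longrightarrow> e \<in> E \<longleftrightarrow> e \<in> F"
  shows "ind_complex S E = ind_complex S F"
proof -
  have "(\<forall>e\<in>E. \<not> e \<subseteq> \<sigma>) \<longleftrightarrow> (\<forall>e\<in>F. \<not> e \<subseteq> \<sigma>)" if "\<sigma> \<subseteq> S" for \<sigma>
    using assms that by (metis subset_trans)
  then show ?thesis unfolding ind_complex_def by auto
qed

text \<open>Deletion and link of v. Since edges are pairs, an edge inside
  \<open>insert v \<tau>\<close> either lies in \<open>\<tau>\<close> or joins v to a vertex of
  \<open>\<tau>\<close>.\<close>

lemma ind_complex_insert:
  assumes E: "two_edges E" and v: "v \<notin> S"
  shows "ind_complex (insert v S) E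
    = join v (ind_complex S E) (ind_complex {u \<in> S. {v, u} \<notin> E} E)"
proof (intro equalityI subsetI)
  fix \<sigma> assume \<sigma>: "\<sigma> \<in> ind_complex (insert v S) E"
  show "\<sigma> \<in> join v (ind_complex S E) (ind_complex {u \<in> S. {v, u} \<notin> E} E)"
  proof (cases "v \<in> \<sigma>")
    case True
    have "\<sigma> - {v} \<in> ind_complex {u \<in> S. {v, u} \<notin> E} E"
      using \<sigma> True by (auto simp: ind_complex_def)
    moreover have "\<sigma> = insert v (\<sigma> - {v})" using True by auto
    ultimately show ?thesis unfolding join_def by blast
  next
    case False
    then show ?thesis using \<sigma> by (auto simp: ind_complex_def join_def)
  qed
next
  fix \<sigma> assume \<sigma>: "\<sigma> \<in> join v (ind_complex S E) (ind_complex {u \<in> S. {v, u} \<notin> E} E)"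
  then consider "\<sigma> \<in> ind_complex S E"
    | \<tau> where "\<sigma> = insert v \<tau>" "\<tau> \<in> ind_complex {u \<in> S. {v, u} \<notin> E} E"
    by (auto simp: join_def)
  then show "\<sigma> \<in> ind_complex (insert v S) E"
  proof cases
    case 1
    then show ?thesis by (auto simp: ind_complex_def)
  next
    case 2
    have "\<not> e \<subseteq> \<sigma>" if "e \<in> E" for e
    proof
      assume sub: "e \<subseteq> \<sigma>"
      obtain u w where e: "u \<noteq> w" "e = {u, w}" using E \<open>e \<in> E\<close> by (auto simp: two_edges_def)
      have "\<not> e \<subseteq> \<tau>" using 2(2) \<open>e \<in> E\<close> by (auto simp: ind_complex_def)
      then have "(u = v \<and> w \<in> \<tau>) \<or> (w = v \<and> u \<in> \<tau>)" using sub 2(1) e by auto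
      then obtain t where "t \<in> \<tau>" "e = {v, t}" using e(2) by auto
      then show False using 2(2) \<open>e \<in> E\<close> by (auto simp: ind_complex_def)
    qed
    then show ?thesis using 2 by (auto simp: ind_complex_def)
  qed
qed

text \<open>An edge that leaves S lies in no subset of S; hence induced subgraphs need no edge sets
  of their own.\<close>

lemma ind_complex_induced: "ind_complex S (induced_edges E S) = ind_complex S E"
  by (rule ind_complex_cong) (auto simp: induced_edges_def)

lemma ind_complex_induced_delete:
  "v \<notin> S \<Longrightarrow> ind_complex S (induced_edges (delete_vertex_edges E v) S) = ind_complex S E"
  by (rule ind_complex_cong) (auto simp: induced_edges_def delete_vertex_edges_def)

section \<open>Homology of induced subgraphs and primality\<close>

context finite_vertices
begin

lemma nontrivial_vertex:
  assumes "two_edges E" "v \<notin> S" "insert v S \<subseteq> U"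
    and "nontrivial k (ind_complex (insert v S) E) n"
  shows "nontrivial k (ind_complex S E) n \<or> nontrivial k (ind_complex {u \<in> S. {v, u} \<notin> E} E) (n - 1)"
  using assms(3,4) unfolding ind_complex_insert[OF assms(1,2)]
  by (intro nontrivial_join[where W = S and v = v]) (use assms(2) in \<open>auto simp: ind_complex_def\<close>)

text \<open>For an isolated vertex the link equals the deletion, so the complex is a cone.\<close>

lemma isolated_vertex_not_nontrivial:
  assumes "two_edges E" "v \<notin> S" "insert v S \<subseteq> U" and iso: "\<And>u. u \<in> S \<Longrightarrow> {v, u} \<notin> E"
  shows "\<not> nontrivial k (ind_complex (insert v S) E) n"
proof -
  have "{u \<in> S. {v, u} \<notin> E} = S" using iso by auto
  then show ?thesis
    unfolding ind_complex_insert[OF assms(1,2)]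
    using cone_not_nontrivial[OF ind_complex_Pow, of S v k E n] assms by simp
qed

text \<open>A nontrivial class has a nonzero representative, hence a face of cardinality n. This
  makes the set under \<open>Max\<close> in \<open>reg\<close> finite.\<close>

lemma nontrivial_le_card: "nontrivial k K n \<Longrightarrow> K \<subseteq> Pow U \<Longrightarrow> n \<le> int (card U)"
proof -
  assume nt: "nontrivial k K n" and K: "K \<subseteq> Pow U"
  obtain f :: "'a set \<Rightarrow> 'b" where f: "f \<in> chain_space K n"
    and nb: "\<forall>g\<in>chain_space K (n + 1). bdry g \<noteq> f"
    using nt unfolding nontrivial_def by blast
  have "f \<noteq> 0" using nb by (metis bdry_arith(4) chain_space_arith(4))
  then obtain \<sigma> where "f \<sigma> \<noteq> 0" by (auto simp: fun_eq_iff)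
  then have "\<sigma> \<subseteq> U" "int (card \<sigma>) = n" using f K by (auto simp: chain_space_def)
  then show ?thesis using card_mono[OF finite_U, of \<sigma>] by simp
qed

text \<open>The empty induced subgraph contributes degree 0, so the set under \<open>Max\<close> in
  \<open>reg\<close> is nonempty.\<close>

lemma nontrivial_empty_face: "nontrivial k {{}} 0"
proof -
  define f :: "'a set \<Rightarrow> 'b" where "f = (\<lambda>\<sigma>. if \<sigma> = {} then 1 else 0)"
  have "f \<in> chain_space {{}} 0" by (auto simp: chain_space_def f_def)
  moreover have "bdry f = 0" by (auto simp: bdry_def f_def fun_eq_iff)
  moreover have "bdry g \<noteq> f" if "g \<in> chain_space {{}} (0 + 1)" for g
  proof -
    have "g = 0" using that by (auto simp: chain_space_def fun_eq_iff)
    then have "bdry g {} \<noteq> f {}" by (simp add: f_def)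
    then show ?thesis by metis
  qed
  ultimately show ?thesis unfolding nontrivial_def by blast
qed

lemma homology_nonzero_ind_complex:
  "S \<subseteq> U \<Longrightarrow> homology_nonzero k S (ind_complex S E) j \<longleftrightarrow> nontrivial k (ind_complex S E) (int j)"
  by (rule homology_nonzero_iff_nontrivial) (unfold ind_complex_def, blast+)

text \<open>Primality without \<open>Max\<close>: every proper subset of V lies in some V - {v}, so
  the vertex conditions together say that the top degree r occurs on V and on no proper
  subset.\<close>

lemma prime_graph_iff:
  assumes V: "V \<subseteq> U" and E: "two_edges E"
  shows "prime_graph k V E \<longleftrightarrow> connected_graph V E \<and>
    (\<exists>r. nontrivial k (ind_complex V E) r \<and>
      (\<forall>S n. S \<subset> V \<longrightarrow> nontrivial k (ind_complex S E) n \<longrightarrow> n < r))"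
proof -
  define J where "J W = {j. \<exists>S\<subseteq>W. nontrivial k (ind_complex S E) (int j)}" for W
  have regV: "reg k V E = Max (J V)"
  proof -
    have "homology_nonzero k S (ind_complex S E) j \<longleftrightarrow> nontrivial k (ind_complex S E) (int j)"
      if "S \<subseteq> V" for S j
      using that V by (intro homology_nonzero_ind_complex) auto
    then show ?thesis
      unfolding reg_def J_def ind_complex_induced by (intro arg_cong[of _ _ Max]) auto
  qed
  have regd: "reg k (V - {v}) (delete_vertex_edges E v) = Max (J (V - {v}))" for v
  proof -
    have "homology_nonzero k S (ind_complex S (induced_edges (delete_vertex_edges E v) S)) j \<longleftrightarrow>
        nontrivial k (ind_complex S E) (int j)" if "S \<subseteq> V - {v}" for S j
      using that V by (subst ind_complex_induced_delete) (auto intro!: homology_nonzero_ind_complex)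
    then show ?thesis unfolding reg_def J_def by (intro arg_cong[of _ _ Max]) auto
  qed
  have fin: "finite (J W)" if "W \<subseteq> V" for W
  proof -
    have "J W \<subseteq> {..card U}"
    proof
      fix j assume "j \<in> J W"
      then obtain S where "S \<subseteq> W" "nontrivial k (ind_complex S E) (int j)" by (auto simp: J_def)
      moreover have "ind_complex S E \<subseteq> Pow U" using \<open>S \<subseteq> W\<close> that V by (auto simp: ind_complex_def)
      ultimately show "j \<in> {..card U}" using nontrivial_le_card[of k "ind_complex S E" "int j"] by simp
    qed
    then show ?thesis by (rule finite_subset) simp
  qed
  have "ind_complex {} E = {{}}" using E by (auto simp: ind_complex_def two_edges_def)
  then have "0 \<in> J W" for W
    unfolding J_def mem_Collect_eq by (intro exI[of _ "{}"]) (simp add: nontrivial_empty_face)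
  then have ne: "J W \<noteq> {}" for W by blast
  have le: "n \<le> int (Max (J W))" if "S \<subseteq> W" "W \<subseteq> V" "nontrivial k (ind_complex S E) n" for S W n
  proof -
    have "nat n \<in> J W" using that nontrivial_nonneg[OF that(3)] by (auto simp: J_def)
    then show ?thesis using Max_ge[OF fin[OF that(2)], of "nat n"] by linarith
  qed
  have ex: "\<exists>S\<subseteq>W. nontrivial k (ind_complex S E) (int (Max (J W)))" if "W \<subseteq> V" for W
    using Max_in[OF fin[OF that] ne] by (simp add: J_def)
  show ?thesis unfolding prime_graph_def regV regd
  proof (intro conj_cong refl iffI)
    assume p: "\<forall>v\<in>V. Max (J (V - {v})) < Max (J V)"
    define r where "r = int (Max (J V))"
    have lt: "n < r" if S: "S \<subset> V" "nontrivial k (ind_complex S E) n" for S n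
    proof -
      obtain v where "v \<in> V" "S \<subseteq> V - {v}" using S(1) by auto
      then have "n \<le> int (Max (J (V - {v})))" using le[of S "V - {v}"] S(2) by auto
      then show ?thesis using p \<open>v \<in> V\<close> unfolding r_def by fastforce
    qed
    moreover obtain S where "S \<subseteq> V" "nontrivial k (ind_complex S E) r"
      using ex[of V] unfolding r_def by blast
    \<comment> \<open>The set S that attains the maximum cannot be proper, by the bound just
      shown.\<close>
    ultimately have "nontrivial k (ind_complex V E) r" by (metis less_irrefl psubsetI)
    with lt show "\<exists>r. nontrivial k (ind_complex V E) r \<and>
      (\<forall>S n. S \<subset> V \<longrightarrow> nontrivial k (ind_complex S E) n \<longrightarrow> n < r)" by blast
  next
    assume "\<exists>r. nontrivial k (ind_complex V E) r \<and>
      (\<forall>S n. S \<subset> V \<longrightarrow> nontrivial k (ind_complex S E) n \<longrightarrow> n < r)"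
    then obtain r where r: "nontrivial k (ind_complex V E) r"
      and lt: "\<And>S n. S \<subset> V \<Longrightarrow> nontrivial k (ind_complex S E) n \<Longrightarrow> n < r" by blast
    show "\<forall>v\<in>V. Max (J (V - {v})) < Max (J V)"
    proof
      fix v assume v: "v \<in> V"
      obtain S where "S \<subseteq> V - {v}" "nontrivial k (ind_complex S E) (int (Max (J (V - {v}))))"
        using ex[of "V - {v}"] by auto
      then have "int (Max (J (V - {v}))) < r" using lt[of S] v by auto
      also have "r \<le> int (Max (J V))" using le[of V V r] r by simp
      finally show "Max (J (V - {v})) < Max (J V)" by simp
    qed
  qed
qed

end

section \<open>Lozin transforms of prime graphs\<close>

definition lozin_setting ::
  "'a set \<Rightarrow> 'a set set \<Rightarrow> 'a \<Rightarrow> 'a set \<Rightarrow> 'a set \<Rightarrow> 'a \<Rightarrow> 'a \<Rightarrow> 'a \<Rightarrow> 'a \<Rightarrow> bool" where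
  "lozin_setting V E x Y Z y a b z \<longleftrightarrow> simple_graph V E \<and> x \<in> V \<and> Y \<union> Z = neighbors V E x \<and>
     y \<notin> V \<and> a \<notin> V \<and> b \<notin> V \<and> z \<notin> V \<and> distinct [y, a, b, z]"

text \<open>Reading the path backwards exchanges y with z, a with b and Y with Z. This symmetry
  halves the later case analysis.\<close>

lemma lozin_setting_swap: "lozin_setting V E x Y Z y a b z \<Longrightarrow> lozin_setting V E x Z Y z b a y"
  by (auto simp: lozin_setting_def)

lemma lozin_edges_swap: "lozin_edges E x Z Y z b a y = lozin_edges E x Y Z y a b z"
  by (auto simp: lozin_edges_def insert_commute)

lemma edge_subset: "simple_graph V E \<Longrightarrow> e \<in> E \<Longrightarrow> e \<subseteq> V"
  unfolding simple_graph_def by (drule conjunct2, drule bspec, assumption) auto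

lemma lozin_subsets:
  assumes "lozin_setting V E x Y Z y a b z"
  shows "Y \<subseteq> V - {x}" "Z \<subseteq> V - {x}"
proof -
  have "x \<notin> neighbors V E x"
    using assms unfolding lozin_setting_def simple_graph_def neighbors_def by fastforce
  moreover have "neighbors V E x \<subseteq> V" by (auto simp: neighbors_def)
  ultimately show "Y \<subseteq> V - {x}" "Z \<subseteq> V - {x}" using assms unfolding lozin_setting_def by blast+
qed

lemma two_edges_lozin:
  assumes L: "lozin_setting V E x Y Z y a b z"
  shows "two_edges E" "two_edges (lozin_edges E x Y Z y a b z)"
proof -
  show E: "two_edges E" using L unfolding lozin_setting_def simple_graph_def two_edges_def by meson
  have "\<exists>u w. u \<noteq> w \<and> e = {u, w}" if "e \<in> lozin_edges E x Y Z y a b z" for e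
  proof -
    from that consider "e \<in> E" | "e \<in> {{y, a}, {a, b}, {b, z}}"
      | u where "u \<in> Y" "e = {y, u}" | u where "u \<in> Z" "e = {z, u}"
      unfolding lozin_edges_def delete_vertex_edges_def by blast
    then show ?thesis
    proof cases
      case 1
      then show ?thesis using E by (simp add: two_edges_def)
    next
      case 2
      then show ?thesis using L unfolding lozin_setting_def by auto
    next
      case 3
      then have "y \<noteq> u" using lozin_subsets[OF L] L unfolding lozin_setting_def by auto
      then show ?thesis using 3 by blast
    next
      case 4
      then have "z \<noteq> u" using lozin_subsets[OF L] L unfolding lozin_setting_def by auto
      then show ?thesis using 4 by blast
    qed
  qed
  then show "two_edges (lozin_edges E x Y Z y a b z)" by (simp add: two_edges_def)
qed

lemma lozin_edges_iff:
  assumes L: "lozin_setting V E x Y Z y a b z"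
  shows "{y, u} \<in> lozin_edges E x Y Z y a b z \<longleftrightarrow> u \<in> Y \<or> u = a"
    and "{a, u} \<in> lozin_edges E x Y Z y a b z \<longleftrightarrow> u = y \<or> u = b"
proof -
  have "{v, u} \<notin> E" if "v \<notin> V" for v
    using L that edge_subset[of V E "{v, u}"] unfolding lozin_setting_def by auto
  then have "{y, u} \<notin> E" "{a, u} \<notin> E" using L unfolding lozin_setting_def by auto
  moreover have "y \<notin> Y \<union> Z" "a \<notin> Y \<union> Z" using L lozin_subsets[OF L] unfolding lozin_setting_def by auto
  moreover have "y \<noteq> a" "y \<noteq> b" "y \<noteq> z" "a \<noteq> b" "a \<noteq> z" "b \<noteq> z"
    using L unfolding lozin_setting_def by auto
  ultimately show "{y, u} \<in> lozin_edges E x Y Z y a b z \<longleftrightarrow> u \<in> Y \<or> u = a"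
    and "{a, u} \<in> lozin_edges E x Y Z y a b z \<longleftrightarrow> u = y \<or> u = b"
    unfolding lozin_edges_def delete_vertex_edges_def by (auto simp: doubleton_eq_iff)
qed

lemma lozin_edges_iff':
  assumes L: "lozin_setting V E x Y Z y a b z"
  shows "{z, u} \<in> lozin_edges E x Y Z y a b z \<longleftrightarrow> u \<in> Z \<or> u = b"
    and "{b, u} \<in> lozin_edges E x Y Z y a b z \<longleftrightarrow> u = z \<or> u = a"
  using lozin_edges_iff[OF lozin_setting_swap[OF L]]
  by (simp_all only: lozin_edges_swap[of E x Z Y z b a y])

text \<open>Each new edge uses a path vertex and each deleted edge contains x, so T sees no
  difference.\<close>

lemma ind_complex_lozin:
  assumes L: "lozin_setting V E x Y Z y a b z" and T: "T \<subseteq> V - {x}"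
  shows "ind_complex T (lozin_edges E x Y Z y a b z) = ind_complex T E"
proof (rule ind_complex_cong)
  fix e assume "e \<subseteq> T"
  moreover have "y \<notin> T" "a \<notin> T" "b \<notin> T" "z \<notin> T" "x \<notin> T"
    using L T unfolding lozin_setting_def by auto
  ultimately show "e \<in> lozin_edges E x Y Z y a b z \<longleftrightarrow> e \<in> E"
    unfolding lozin_edges_def delete_vertex_edges_def by auto
qed

text \<open>Every vertex is connected to y. An old vertex follows a walk in G towards x; the vertex
  from which the walk first enters x lies in Y or Z, hence is joined to y or z instead.\<close>

lemma connected_lozin:
  assumes L: "lozin_setting V E x Y Z y a b z" and c: "connected_graph V E"
  shows "connected_graph (lozin_vertices V x y a b z) (lozin_edges E x Y Z y a b z)"
proof -
  let ?F = "lozin_edges E x Y Z y a b z"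
  define R where "R = (\<lambda>p q. {p, q} \<in> ?F)"
  have sym: "R p q \<Longrightarrow> R q p" for p q by (simp add: R_def insert_commute)
  have "R\<^sup>*\<^sup>* q p" if "R\<^sup>*\<^sup>* p q" for p q
    using that by induction (auto intro: sym converse_rtranclp_into_rtranclp)
  note symr = this
  have path: "R a y" "R b a" "R z b" unfolding R_def lozin_edges_def by (auto simp: insert_commute)
  have YZ: "u \<in> Y \<Longrightarrow> R y u" "u \<in> Z \<Longrightarrow> R z u" for u
    unfolding R_def lozin_edges_def by (rule UnI1, rule UnI2, blast) (rule UnI2, blast)
  from path have az: "R\<^sup>*\<^sup>* y y" "R\<^sup>*\<^sup>* a y" "R\<^sup>*\<^sup>* b y" "R\<^sup>*\<^sup>* z y"
    by (meson converse_rtranclp_into_rtranclp rtranclp.rtrancl_refl)+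
  have toy: "R\<^sup>*\<^sup>* u y" if "u \<in> V" "u \<noteq> x" for u
  proof -
    have "(\<lambda>p q. {p, q} \<in> E)\<^sup>*\<^sup>* u x"
      using c that L unfolding connected_graph_def lozin_setting_def by blast
    then show ?thesis using that(2)
    proof (induction rule: converse_rtranclp_induct)
      case base
      then show ?case by simp
    next
      case (step u w)
      show ?case
      proof (cases "w = x")
        case True
        have "u \<in> V" using step(1) edge_subset L unfolding lozin_setting_def by blast
        moreover have "{x, u} \<in> E" using step(1) True by (simp add: insert_commute)
        ultimately have "u \<in> neighbors V E x" by (simp add: neighbors_def)
        moreover have "Y \<union> Z = neighbors V E x" using L unfolding lozin_setting_def by (elim conjE)
        ultimately have "u \<in> Y \<or> u \<in> Z" by (metis Un_iff)
        then have "R y u \<or> R z u" using YZ by blast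
        then have "R u y \<or> R u z" using sym by blast
        then show ?thesis using az by (meson converse_rtranclp_into_rtranclp)
      next
        case False
        then have "R u w"
          using step(1,4) unfolding R_def lozin_edges_def delete_vertex_edges_def by auto
        then show ?thesis using step.IH[OF False] by (rule converse_rtranclp_into_rtranclp)
      qed
    qed
  qed
  have all: "R\<^sup>*\<^sup>* u y" if u: "u \<in> lozin_vertices V x y a b z" for u
  proof -
    consider "u = y" | "u = a" | "u = b" | "u = z" | "u \<in> V" "u \<noteq> x"
      using u unfolding lozin_vertices_def by blast
    then show ?thesis by cases (simp_all only: az toy simp_thms)
  qed
  have "R\<^sup>*\<^sup>* u w" if "u \<in> lozin_vertices V x y a b z" "w \<in> lozin_vertices V x y a b z" for u w
    by (rule rtranclp_trans[OF all[OF that(1)] symr[OF all[OF that(2)]]])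
  moreover have "y \<in> lozin_vertices V x y a b z" by (simp add: lozin_vertices_def)
  ultimately show ?thesis unfolding connected_graph_def R_def by blast
qed

section \<open>Homology of induced subgraphs of the Lozin transform\<close>

context finite_vertices
begin

text \<open>On T the vertices adjacent neither to y nor to z are the non-neighbours of x, so AY
  \<inter> AZ is the link of x in the graph on \<open>insert x T\<close>. T = V - {x} gives the
  suspension for L itself, smaller T the bound for proper subgraphs containing the path.\<close>

lemma nontrivial_lozin:
  assumes L: "lozin_setting V E x Y Z y a b z" and U: "V \<union> {y, a, b, z} \<subseteq> U" and T: "T \<subseteq> V - {x}"
  shows "nontrivial k (ind_complex (T \<union> {y, a, b, z}) (lozin_edges E x Y Z y a b z)) (n + 1) \<longleftrightarrow>
    nontrivial k (ind_complex (insert x T) E) n"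
proof -
  let ?F = "lozin_edges E x Y Z y a b z"
  have out: "y \<notin> V" "a \<notin> V" "b \<notin> V" "z \<notin> V" "y \<noteq> a" "y \<noteq> b" "y \<noteq> z" "a \<noteq> b" "a \<noteq> z" "b \<noteq> z"
    and x: "x \<in> V" and N: "Y \<union> Z = neighbors V E x"
    using L unfolding lozin_setting_def by auto
  have out': "y \<notin> T" "a \<notin> T" "b \<notin> T" "z \<notin> T" "x \<notin> T" using out(1-4) T by blast+
  note tF = two_edges_lozin(2)[OF L] and tE = two_edges_lozin(1)[OF L]
  note adj = lozin_edges_iff[OF L] lozin_edges_iff'[OF L]
  have sub: "Y \<subseteq> V" "Z \<subseteq> V" using lozin_subsets[OF L] by auto
  \<comment> \<open>Stated for all S in T, because z is added both to T and to the link T - Y of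
    y.\<close>
  have z: "ind_complex (insert z S) ?F = join z (ind_complex S ?F) (ind_complex (S - Z) ?F)"
    if "S \<subseteq> T" for S
  proof -
    have "{u \<in> S. {z, u} \<notin> ?F} = S - Z" unfolding adj(3) using that out' by auto
    then show ?thesis using ind_complex_insert[OF tF, of z S] that out' by auto
  qed
  have y: "ind_complex (insert y T) ?F = join y (ind_complex T ?F) (ind_complex (T - Y) ?F)"
  proof -
    have "{u \<in> T. {y, u} \<notin> ?F} = T - Y" unfolding adj(1) using out' by auto
    then show ?thesis using ind_complex_insert[OF tF, of y T] out' by auto
  qed
  have yz: "ind_complex (insert y (insert z T)) ?F
      = join y (ind_complex (insert z T) ?F) (ind_complex (insert z (T - Y)) ?F)"
  proof -
    have "{u \<in> insert z T. {y, u} \<notin> ?F} = insert z (T - Y)" unfolding adj(1) using out out' sub by auto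
    then show ?thesis using ind_complex_insert[OF tF, of y "insert z T"] out out' by auto
  qed
  have ayz: "ind_complex (insert a (insert y (insert z T))) ?F
      = join a (ind_complex (insert y (insert z T)) ?F) (ind_complex (insert z T) ?F)"
  proof -
    have "{u \<in> insert y (insert z T). {a, u} \<notin> ?F} = insert z T" unfolding adj(2) using out out' by auto
    then show ?thesis using ind_complex_insert[OF tF, of a "insert y (insert z T)"] out out' by auto
  qed
  have bayz: "ind_complex (insert b (insert a (insert y (insert z T)))) ?F
      = join b (ind_complex (insert a (insert y (insert z T))) ?F) (ind_complex (insert y T) ?F)"
  proof -
    have "{u \<in> insert a (insert y (insert z T)). {b, u} \<notin> ?F} = insert y T" unfolding adj(4) using out out' by auto
    then show ?thesis
      using ind_complex_insert[OF tF, of b "insert a (insert y (insert z T))"] out out' by auto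
  qed
  define A AY AZ where "A = ind_complex T ?F" and "AY = ind_complex (T - Y) ?F"
    and "AZ = ind_complex (T - Z) ?F"
  have AYZ: "ind_complex (T - Y - Z) ?F = AY \<inter> AZ"
    unfolding AY_def AZ_def ind_complex_Int by (rule arg_cong[of _ _ "\<lambda>S. ind_complex S ?F"]) auto
  have "T \<union> {y, a, b, z} = insert b (insert a (insert y (insert z T)))" by auto
  then have 1: "ind_complex (T \<union> {y, a, b, z}) ?F = lozin_complex y a b z A AY AZ"
    unfolding lozin_complex_def AYZ[symmetric] unfolding A_def AY_def AZ_def
    by (simp add: bayz ayz yz y z[of T] z[of "T - Y"])
  have "{u \<in> T. {x, u} \<notin> E} = T - Y - Z"
    using N T by (auto simp: neighbors_def)
  moreover have "T - Y - Z \<subseteq> V - {x}" using T by blast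
  ultimately have 2: "ind_complex (insert x T) E = join x A (AY \<inter> AZ)"
    using ind_complex_insert[OF tE, of x T] out' ind_complex_lozin[OF L] T
    unfolding AYZ[symmetric] A_def by simp
  show ?thesis unfolding 1 2
  proof (rule nontrivial_lozin_complex)
    show "A \<subseteq> Pow T" "AY \<subseteq> A" "AZ \<subseteq> A"
      unfolding A_def AY_def AZ_def by (auto simp: ind_complex_def)
  qed (use out out' U T x in auto)
qed

section \<open>Induced subgraphs missing a path vertex\<close>

context
  fixes k :: "'k::field itself" and V E x Y Z y a b z and r :: int
  assumes L: "lozin_setting V E x Y Z y a b z" and U: "V \<union> {y, a, b, z} \<subseteq> U"
    and top: "\<And>S n. S \<subset> V \<Longrightarrow> nontrivial k (ind_complex S E) n \<Longrightarrow> n < r"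
begin

abbreviation (input) "F \<equiv> lozin_edges E x Y Z y a b z"

lemma lozin_facts:
  "y \<notin> V" "a \<notin> V" "b \<notin> V" "z \<notin> V" "y \<noteq> a" "y \<noteq> b" "y \<noteq> z" "a \<noteq> b" "a \<noteq> z" "b \<noteq> z"
  "a \<noteq> y" "b \<noteq> y" "z \<noteq> y" "b \<noteq> a" "z \<noteq> a" "z \<noteq> b" "x \<in> V" "Y \<union> Z = neighbors V E x"
  using L unfolding lozin_setting_def by auto

lemmas adj = lozin_edges_iff[OF L] lozin_edges_iff'[OF L]

lemma lozin_old_vertices:
  assumes "T \<subseteq> V - {x}" "nontrivial k (ind_complex T F) n"
  shows "n < r"
  using top[of T n] assms lozin_facts unfolding ind_complex_lozin[OF L assms(1)] by blast

text \<open>Outside Z, the vertices y and x have the same neighbours in T, so y can be renamed to x.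
  The resulting vertex set \<open>insert x T\<close> misses Z and is therefore proper in V.\<close>

lemma lozin_y_without_Z:
  assumes Z: "Z \<noteq> {}" and T: "T \<subseteq> V - {x} - Z" and nt: "nontrivial k (ind_complex (insert y T) F) n"
  shows "n < r"
proof -
  have T': "T \<subseteq> V - {x}" "y \<notin> T" "a \<notin> T" "x \<notin> T" using T lozin_facts by auto
  have "{u \<in> T. {y, u} \<notin> F} = {u \<in> T. {x, u} \<notin> E}"
    using T T' lozin_facts(18) adj by (auto simp: neighbors_def)
  moreover have "ind_complex {u \<in> T. {x, u} \<notin> E} F = ind_complex {u \<in> T. {x, u} \<notin> E} E"
    using T' by (intro ind_complex_lozin[OF L]) auto
  ultimately have "nontrivial k (join y (ind_complex T E) (ind_complex {u \<in> T. {x, u} \<notin> E} E)) n"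
    using nt ind_complex_insert[OF two_edges_lozin(2)[OF L] T'(2)] ind_complex_lozin[OF L T'(1)] by simp
  then have "nontrivial k (join x (ind_complex T E) (ind_complex {u \<in> T. {x, u} \<notin> E} E)) n"
    by (rule nontrivial_change_apex[rotated -1, where W = T])
      (use T' U lozin_facts in \<open>auto simp: ind_complex_def\<close>)
  then have "nontrivial k (ind_complex (insert x T) E) n"
    using ind_complex_insert[OF two_edges_lozin(1)[OF L] T'(4)] by simp
  moreover have "insert x T \<subset> V"
    using T Z lozin_subsets(2)[OF L] lozin_facts(17) by auto
  ultimately show ?thesis by (rule top[rotated])
qed

text \<open>If b is present, it is isolated and there is no homology. Otherwise peeling off y leaves
  old vertices without x, at the cost of at most one degree.\<close>

lemma lozin_without_az:
  assumes S: "S \<subseteq> insert y (insert b (V - {x}))" and nt: "nontrivial k (ind_complex S F) n"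
  shows "n \<le> r"
proof (cases "b \<in> S")
  case True
  then obtain S' where S': "S = insert b S'" "b \<notin> S'" by (meson mk_disjoint_insert)
  have "\<not> nontrivial k (ind_complex (insert b S') F) n"
    using S S' U lozin_facts by (intro isolated_vertex_not_nontrivial[OF two_edges_lozin(2)[OF L]])
      (auto simp: adj)
  then show ?thesis using nt S' by simp
next
  case b: False
  show ?thesis
  proof (cases "y \<in> S")
    case True
    then obtain T where T: "S = insert y T" "y \<notin> T" by (meson mk_disjoint_insert)
    have T': "T \<subseteq> V - {x}" using S T b by auto
    have "nontrivial k (ind_complex T F) n \<or> nontrivial k (ind_complex {u \<in> T. {y, u} \<notin> F} F) (n - 1)"
      using nt T T' U by (intro nontrivial_vertex[OF two_edges_lozin(2)[OF L]]) auto
    then show ?thesis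
      using lozin_old_vertices[OF T', of n] lozin_old_vertices[of "{u \<in> T. {y, u} \<notin> F}" "n - 1"] T'
      by fastforce
  next
    case False
    then have "S \<subseteq> V - {x}" using S b by auto
    then show ?thesis using lozin_old_vertices[OF _ nt] by simp
  qed
qed

text \<open>Peel off z. The deletion has neither a nor z; the link has lost b and Z, so it consists
  of old vertices outside Z and possibly y, where the strict bound of
  \<open>lozin_y_without_Z\<close> pays for the lost degree.\<close>

lemma lozin_without_a:
  assumes Z: "Z \<noteq> {}" and S: "S \<subseteq> insert y (insert b (insert z (V - {x})))"
    and nt: "nontrivial k (ind_complex S F) n"
  shows "n \<le> r"
proof (cases "z \<in> S")
  case True
  then obtain T where T: "S = insert z T" "z \<notin> T" by (meson mk_disjoint_insert)
  define M where "M = {u \<in> T. {z, u} \<notin> F}"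
  have T': "T \<subseteq> insert y (insert b (V - {x}))" using S T by auto
  have M: "M \<subseteq> insert y (V - {x} - Z)" using T' lozin_facts by (auto simp: M_def adj)
  have "nontrivial k (ind_complex T F) n \<or> nontrivial k (ind_complex M F) (n - 1)"
    unfolding M_def using nt T T' U by (intro nontrivial_vertex[OF two_edges_lozin(2)[OF L]]) auto
  then show ?thesis
  proof
    assume "nontrivial k (ind_complex T F) n"
    then show ?thesis by (rule lozin_without_az[OF T'])
  next
    assume ntM: "nontrivial k (ind_complex M F) (n - 1)"
    have "n - 1 < r"
    proof (cases "y \<in> M")
      case True
      then have "M = insert y (M - {y})" "M - {y} \<subseteq> V - {x} - Z" using M by auto
      then show ?thesis using lozin_y_without_Z[OF Z, of "M - {y}" "n - 1"] ntM by simp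
    next
      case False
      then have "M \<subseteq> V - {x}" using M by auto
      then show ?thesis by (rule lozin_old_vertices[OF _ ntM])
    qed
    then show ?thesis by simp
  qed
next
  case False
  then have "S \<subseteq> insert y (insert b (V - {x}))" using S by auto
  then show ?thesis by (rule lozin_without_az[OF _ nt])
qed

text \<open>If a is present, b must be too, since otherwise a is isolated. Peel off b: in the
  deletion a is isolated, so the class survives in the link, which has lost a and z and consists of
  old vertices.\<close>

lemma lozin_without_y:
  assumes Z: "Z \<noteq> {}" and S: "S \<subseteq> insert a (insert b (insert z (V - {x})))"
    and nt: "nontrivial k (ind_complex S F) n"
  shows "n \<le> r"
proof (cases "a \<in> S")
  case False
  then have "S \<subseteq> insert y (insert b (insert z (V - {x})))" using S by auto
  then show ?thesis by (rule lozin_without_a[OF Z _ nt])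
next
  case a: True
  have iso: "\<not> nontrivial k (ind_complex S' F) m"
    if "a \<in> S'" "b \<notin> S'" "S' \<subseteq> S" for S' m
  proof -
    obtain T where T: "S' = insert a T" "a \<notin> T" using \<open>a \<in> S'\<close> by (meson mk_disjoint_insert)
    have "\<not> nontrivial k (ind_complex (insert a T) F) m"
      using T S that U lozin_facts by (intro isolated_vertex_not_nontrivial[OF two_edges_lozin(2)[OF L]])
        (auto simp: adj)
    then show ?thesis using T by simp
  qed
  have b: "b \<in> S" using iso[of S n] a nt by blast
  then obtain T where T: "S = insert b T" "b \<notin> T" by (meson mk_disjoint_insert)
  define M where "M = {u \<in> T. {b, u} \<notin> F}"
  have "nontrivial k (ind_complex T F) n \<or> nontrivial k (ind_complex M F) (n - 1)"
    unfolding M_def using nt T S U by (intro nontrivial_vertex[OF two_edges_lozin(2)[OF L]]) auto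
  moreover have "\<not> nontrivial k (ind_complex T F) n"
    using iso[of T n] a T lozin_facts by auto
  moreover have "M \<subseteq> V - {x}" using T S by (auto simp: M_def adj)
  ultimately have "n - 1 < r" using lozin_old_vertices by blast
  then show ?thesis by simp
qed

end

text \<open>The cases without b or without z are those without a or without y for the reversed path,
  where the nonemptiness of Y replaces that of Z.\<close>

lemma nontrivial_lozin_proper:
  assumes L: "lozin_setting V E x Y Z y a b z" and U: "V \<union> {y, a, b, z} \<subseteq> U"
    and top: "\<And>S n. S \<subset> V \<Longrightarrow> nontrivial k (ind_complex S E) n \<Longrightarrow> n < r"
    and YZ: "Y \<noteq> {}" "Z \<noteq> {}" and S: "S \<subset> lozin_vertices V x y a b z"
    and nt: "nontrivial k (ind_complex S (lozin_edges E x Y Z y a b z)) n"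
  shows "n < r + 1"
proof -
  have L': "lozin_setting V E x Z Y z b a y" using L by (rule lozin_setting_swap)
  have U': "V \<union> {z, b, a, y} \<subseteq> U" using U by auto
  have nt': "nontrivial k (ind_complex S (lozin_edges E x Z Y z b a y)) n"
    using nt by (simp only: lozin_edges_swap[of E x Z Y z b a y])
  have S': "S \<subseteq> (V - {x}) \<union> {y, a, b, z}" using S unfolding lozin_vertices_def by auto
  consider "a \<notin> S" | "b \<notin> S" | "y \<notin> S" | "z \<notin> S" | "{y, a, b, z} \<subseteq> S" by auto
  then show ?thesis
  proof cases
    case 1
    then have "S \<subseteq> insert y (insert b (insert z (V - {x})))" using S' by auto
    then show ?thesis using lozin_without_a[OF L U top YZ(2) _ nt] by simp
  next
    case 2
    then have "S \<subseteq> insert z (insert a (insert y (V - {x})))" using S' by auto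
    then show ?thesis using lozin_without_a[OF L' U' top YZ(1) _ nt'] by simp
  next
    case 3
    then have "S \<subseteq> insert a (insert b (insert z (V - {x})))" using S' by auto
    then show ?thesis using lozin_without_y[OF L U top YZ(2) _ nt] by simp
  next
    case 4
    then have "S \<subseteq> insert b (insert a (insert y (V - {x})))" using S' by auto
    then show ?thesis using lozin_without_y[OF L' U' top YZ(1) _ nt'] by simp
  next
    case 5
    define T where "T = S - {y, a, b, z}"
    have Se: "S = T \<union> {y, a, b, z}" using 5 by (auto simp: T_def)
    have T: "T \<subseteq> V - {x}" using S' by (auto simp: T_def)
    have "nontrivial k (ind_complex (insert x T) E) (n - 1)"
      using nt nontrivial_lozin[OF L U T, of k "n - 1"] by (simp add: Se)
    moreover have "insert x T \<subset> V"
    proof -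
      \<comment> \<open>S is proper but contains the whole path, so the vertex it misses is an old
        one.\<close>
      have "T \<noteq> V - {x}" using S Se unfolding lozin_vertices_def by auto
      then show ?thesis using T L unfolding lozin_setting_def by auto
    qed
    ultimately show ?thesis using top[of "insert x T" "n - 1"] by simp
  qed
qed

end

theorem mainTheorem15:
  fixes k :: "'k::field itself"
    and V :: "'a::linorder set" and E :: "'a set set"
    and x y a b z :: 'a and Y Z :: "'a set"
  assumes "simple_graph V E"
    and "prime_graph k V E"
    and "\<forall>v\<in>V. card (neighbors V E v) \<ge> 2"
    and "x \<in> V"
    and "Y \<union> Z = neighbors V E x" and "Y \<inter> Z = {}" and "Y \<noteq> {}" and "Z \<noteq> {}"
    and "y \<notin> V" and "a \<notin> V" and "b \<notin> V" and "z \<notin> V"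
    and "distinct [y, a, b, z]"
  shows "prime_graph k (lozin_vertices V x y a b z) (lozin_edges E x Y Z y a b z)"
proof -
  have L: "lozin_setting V E x Y Z y a b z" using assms unfolding lozin_setting_def by auto
  \<comment> \<open>The ground set contains the vertices of both graphs, including x, so that their
    homology is computed with the same boundary operator.\<close>
  interpret finite_vertices "V \<union> {y, a, b, z}"
    by unfold_locales (use assms(1) in \<open>simp add: simple_graph_def\<close>)
  obtain r where r: "nontrivial k (ind_complex V E) r"
    and top: "\<And>S n. S \<subset> V \<Longrightarrow> nontrivial k (ind_complex S E) n \<Longrightarrow> n < r"
    and conn: "connected_graph V E"
    using assms(2) unfolding prime_graph_iff[OF Un_upper1 two_edges_lozin(1)[OF L]] by blast
  \<comment> \<open>With all old vertices in T, the top class of G in degree r becomes a class on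
    the whole of L in degree r + 1.\<close>
  have "insert x (V - {x}) = V" using assms(4) by auto
  then have "nontrivial k (ind_complex (lozin_vertices V x y a b z) (lozin_edges E x Y Z y a b z)) (r + 1)"
    using nontrivial_lozin[OF L subset_refl, of "V - {x}" k r] r unfolding lozin_vertices_def by simp
  moreover have "n < r + 1" if "S \<subset> lozin_vertices V x y a b z"
    "nontrivial k (ind_complex S (lozin_edges E x Y Z y a b z)) n" for S n
    using nontrivial_lozin_proper[OF L subset_refl top assms(7,8) that] .
  moreover have "lozin_vertices V x y a b z \<subseteq> V \<union> {y, a, b, z}" by (auto simp: lozin_vertices_def)
  ultimately show ?thesis
    using prime_graph_iff[OF _ two_edges_lozin(2)[OF L]] connected_lozin[OF L conn] by blast
qed

end
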